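(* Let $\mathbb{F}_2=\{([x:y:z],[u:v])\in\mathbb{P}^2\times\mathbb{P}^1\mid yv^2=zu^2\}$ be the second Hirzebruch surface, and let $G=\mathbb{C}^*\times\mathbb{C}^*$ act on $\mathbb{F}_2$ by $$(a,d)\cdot([x:y:z],[u:v])=([x:a^2y:d^2z],[au:dv]).$$ Let $\pi:\mathcal{X}\to(\mathbb{C},0)$ be the Kuranishi (semi-universal) family of $\mathbb{F}_2$ given by $$\mathcal{X}=\{([x:y:z],[u:v],t)\in\mathbb{P}^2\times\mathbb{P}^1\times\mathbb{C}\mid yv^2-zu^2-txuv=0\},\qquad \pi([x:y:z],[u:v],t)=t.$$ If the $G$-action on $\mathbb{F}_2=\pi^{-1}(0)$ is extended to a $G$-action on $\pi:\mathcal{X}\to(\mathbb{C},0)$, then $G$ does not act trivially on the base $(\mathbb{C},0)$; more precisely, neither of the two subgroups $\mathbb{C}^*\times\{1\}$ and $\{1\}\times\mathbb{C}^*$ acts trivially on the base.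
   Context: The family is regarded as a germ of deformation along its central fiber $\pi^{-1}(0)=\mathbb{F}_2$, over the germ $(\mathbb{C},0)$. An extension of the $G$-action on $\mathbb{F}_2$ to $\pi:\mathcal{X}\to(\mathbb{C},0)$ consists of (possibly only local) holomorphic actions of $G$ on $\mathcal{X}$ and on the base, i.e. holomorphic maps $\Phi$, from an open neighborhood of $\{1\}\times\mathbb{F}_2$ in $G\times\mathcal{X}$ to $\mathcal{X}$, and $\varphi$, from an open neighborhood of $(1,0)$ in $G\times\mathbb{C}$ to $\mathbb{C}$, which satisfy the identity and composition axioms of a group action wherever both sides are defined, such that $\pi(\Phi(g,p))=\varphi(g,\pi(p))$ wherever both sides are defined and such that $\Phi(g,p)=g\cdot p$ for $p\in\mathbb{F}_2$ (wherever $\Phi(g,p)$ is defined). Globally defined actions are included as a special case. A subgroup $H\subseteq G$ acts trivially on the base if $\varphi(h,t)=t$ for all $(h,t)$ in some neighborhood of $(1,0)$ in $H\times\mathbb{C}$. *)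

theory Defs
  imports "HOL-Analysis.Analysis"
begin

section \<open>Complex vector spaces and holomorphic maps of several variables\<close>

class complex_vector = real_vector +
  fixes scaleC :: "complex \<Rightarrow> 'a \<Rightarrow> 'a"
  assumes scaleC_add_right: "scaleC c (x + y) = scaleC c x + scaleC c y"
    and scaleC_add_left: "scaleC (b + c) x = scaleC b x + scaleC c x"
    and scaleC_scaleC: "scaleC b (scaleC c x) = scaleC (b * c) x"
    and scaleC_of_real: "scaleC (complex_of_real r) x = r *\<^sub>R x"

instantiation complex :: complex_vector
begin
definition scaleC_complex :: "complex \<Rightarrow> complex \<Rightarrow> complex"
  where "scaleC_complex c x = c * x"
instance
  by standard (simp_all add: scaleC_complex_def algebra_simps scaleR_conv_of_real)
end

instantiation prod :: (complex_vector, complex_vector) complex_vector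
begin
definition scaleC_prod :: "complex \<Rightarrow> 'a \<times> 'b \<Rightarrow> 'a \<times> 'b"
  where "scaleC_prod c p = (scaleC c (fst p), scaleC c (snd p))"
instance
  by standard
    (simp_all add: scaleC_prod_def prod_eq_iff scaleC_add_right scaleC_add_left
      scaleC_scaleC scaleC_of_real)
end

instantiation vec :: (complex_vector, finite) complex_vector
begin
definition scaleC_vec :: "complex \<Rightarrow> 'a ^ 'b \<Rightarrow> 'a ^ 'b"
  where "scaleC_vec c x = (\<chi> i. scaleC c (x $ i))"
instance
  by standard
    (simp_all add: scaleC_vec_def vec_eq_iff scaleC_add_right scaleC_add_left
      scaleC_scaleC scaleC_of_real)
end

definition holomorphic_map_on ::
    "('a::{complex_vector,real_normed_vector} \<Rightarrow> 'b::{complex_vector,real_normed_vector})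
      \<Rightarrow> 'a set \<Rightarrow> bool"
  where "holomorphic_map_on f S \<longleftrightarrow>
    open S \<and>
    (\<forall>x\<in>S. \<exists>D. (f has_derivative D) (at x) \<and> (\<forall>c v. D (scaleC c v) = scaleC c (D v)))"

lemma holomorphic_map_on_complex_iff:
  fixes f :: "complex \<Rightarrow> complex"
  assumes "open S"
  shows "holomorphic_map_on f S \<longleftrightarrow> f holomorphic_on S"
proof -
  have "(\<exists>D. (f has_derivative D) (at x) \<and> (\<forall>c v. D (scaleC c v) = scaleC c (D v)))
      \<longleftrightarrow> f field_differentiable at x" for x
  proof
    assume "\<exists>D. (f has_derivative D) (at x) \<and> (\<forall>c v. D (scaleC c v) = scaleC c (D v))"
    then obtain D where D: "(f has_derivative D) (at x)" "\<And>c v. D (c * v) = c * D v"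
      unfolding scaleC_complex_def by blast
    have "D = (*) (D 1)"
    proof
      show "D c = D 1 * c" for c
        using D(2)[of c 1] by (metis mult.commute mult.right_neutral)
    qed
    with D(1) have "(f has_field_derivative D 1) (at x)"
      by (simp add: has_field_derivative_def)
    then show "f field_differentiable at x"
      by (auto simp: field_differentiable_def)
  next
    assume "f field_differentiable at x"
    then obtain d where "(f has_derivative (*) d) (at x)"
      by (auto simp: field_differentiable_def has_field_derivative_def)
    then show "\<exists>D. (f has_derivative D) (at x) \<and> (\<forall>c v. D (scaleC c v) = scaleC c (D v))"
      by (intro exI[of _ "(*) d"]) (simp add: scaleC_complex_def)
  qed
  then show ?thesis
    unfolding holomorphic_map_on_def holomorphic_on_def
    by (simp only: assms at_within_open[OF _ assms] simp_thms cong: ball_cong)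
qed

section \<open>Complex projective spaces\<close>

text \<open>The quotient type below is the projectivization of \<^typ>\<open>complex ^ 'n\<close>; the index type
  counts homogeneous coordinates, so the projective plane has index type 3.\<close>

quotient_type 'n cproj = "complex ^ 'n" / partial:
  "\<lambda>v w. v \<noteq> 0 \<and> w \<noteq> 0 \<and> (\<exists>c. c \<noteq> 0 \<and> w = c *s v)"
proof (rule part_equivpI)
  show "\<exists>x::complex ^ 'n. x \<noteq> 0 \<and> x \<noteq> 0 \<and> (\<exists>c. c \<noteq> 0 \<and> x = c *s x)"
    by (rule exI[of _ "\<chi> i. 1"]) (auto simp: vec_eq_iff intro!: exI[of _ 1])
  show "symp (\<lambda>v w::complex ^ 'n. v \<noteq> 0 \<and> w \<noteq> 0 \<and> (\<exists>c. c \<noteq> 0 \<and> w = c *s v))"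
  proof (rule sympI, safe)
    fix v :: "complex ^ 'n" and c :: complex
    assume "c \<noteq> 0"
    then show "\<exists>ca. ca \<noteq> 0 \<and> v = ca *s (c *s v)"
      by (intro exI[of _ "inverse c"]) (auto simp: vec_eq_iff)
  qed
  show "transp (\<lambda>v w::complex ^ 'n. v \<noteq> 0 \<and> w \<noteq> 0 \<and> (\<exists>c. c \<noteq> 0 \<and> w = c *s v))"
    by (rule transpI) (metis mult_eq_0_iff vector_smult_assoc)
qed

lemma abs_cproj_eq_iff:
  assumes "v \<noteq> 0" "w \<noteq> 0"
  shows "abs_cproj v = abs_cproj w \<longleftrightarrow> (\<exists>c. c \<noteq> 0 \<and> w = c *s v)"
proof -
  have "v = (1::complex) *s v" "w = (1::complex) *s w" by simp_all
  then have "v \<noteq> 0 \<and> v \<noteq> 0 \<and> (\<exists>c. c \<noteq> 0 \<and> v = c *s v)"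
    "w \<noteq> 0 \<and> w \<noteq> 0 \<and> (\<exists>c. c \<noteq> 0 \<and> w = c *s w)"
    using assms by (metis one_neq_zero)+
  with Quotient_rel[OF Quotient_cproj, of v w] assms show ?thesis by blast
qed

lemma rep_cproj_nonzero: "rep_cproj P \<noteq> 0"
  using Quotient_rep_reflp[OF Quotient_cproj, of P] by blast

lemma abs_rep_cproj: "abs_cproj (rep_cproj P) = P"
  using Quotient_abs_rep[OF Quotient_cproj] .

text \<open>The quotient topology.\<close>

instantiation cproj :: (finite) topological_space
begin
definition open_cproj :: "'a cproj set \<Rightarrow> bool"
  where "open_cproj U \<longleftrightarrow> open {v. v \<noteq> 0 \<and> abs_cproj v \<in> U}"
instance
proof
  have "{v::complex ^ 'a. v \<noteq> 0 \<and> abs_cproj v \<in> UNIV} = - {0}" by auto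
  then show "open (UNIV :: 'a cproj set)"
    by (simp add: open_cproj_def open_Compl)
next
  fix S T :: "'a cproj set"
  assume "open S" "open T"
  moreover have "{v. v \<noteq> 0 \<and> abs_cproj v \<in> S \<inter> T} =
      {v. v \<noteq> 0 \<and> abs_cproj v \<in> S} \<inter> {v. v \<noteq> 0 \<and> abs_cproj v \<in> T}" by auto
  ultimately show "open (S \<inter> T)" by (simp add: open_cproj_def open_Int)
next
  fix K :: "'a cproj set set"
  assume "\<forall>S\<in>K. open S"
  moreover have "{v. v \<noteq> 0 \<and> abs_cproj v \<in> \<Union>K} =
      (\<Union>S\<in>K. {v. v \<noteq> 0 \<and> abs_cproj v \<in> S})" by auto
  ultimately show "open (\<Union>K)" by (auto simp: open_cproj_def)
qed
end

definition plane_pt :: "complex \<Rightarrow> complex \<Rightarrow> complex \<Rightarrow> 3 cproj"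
  where "plane_pt x y z = abs_cproj (vector [x, y, z])"

definition line_pt :: "complex \<Rightarrow> complex \<Rightarrow> 2 cproj"
  where "line_pt u v = abs_cproj (vector [u, v])"

lemma vector_3_eq_0_iff: "(vector [x, y, z] :: complex ^ 3) = 0 \<longleftrightarrow> (x, y, z) = (0, 0, 0)"
  by (simp add: vec_eq_iff forall_3)

lemma vector_2_eq_0_iff: "(vector [u, v] :: complex ^ 2) = 0 \<longleftrightarrow> (u, v) = (0, 0)"
  by (simp add: vec_eq_iff forall_2)

lemma plane_pt_eq_iff:
  assumes "(x, y, z) \<noteq> (0, 0, 0)" "(x', y', z') \<noteq> (0, 0, 0)"
  shows "plane_pt x y z = plane_pt x' y' z' \<longleftrightarrow>
    (\<exists>c. c \<noteq> 0 \<and> x' = c * x \<and> y' = c * y \<and> z' = c * z)"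
  using assms unfolding plane_pt_def
  by (subst abs_cproj_eq_iff) (auto simp: vector_3_eq_0_iff vec_eq_iff forall_3)

lemma line_pt_eq_iff:
  assumes "(u, v) \<noteq> (0, 0)" "(u', v') \<noteq> (0, 0)"
  shows "line_pt u v = line_pt u' v' \<longleftrightarrow> (\<exists>c. c \<noteq> 0 \<and> u' = c * u \<and> v' = c * v)"
  using assms unfolding line_pt_def
  by (subst abs_cproj_eq_iff) (auto simp: vector_2_eq_0_iff vec_eq_iff forall_2)

section \<open>The second Hirzebruch surface and its family\<close>

definition F2 :: "(3 cproj \<times> 2 cproj) set"
  where "F2 = {(plane_pt x y z, line_pt u v) | x y z u v.
    (x, y, z) \<noteq> (0, 0, 0) \<and> (u, v) \<noteq> (0, 0) \<and> y * v\<^sup>2 = z * u\<^sup>2}"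

definition X_fam :: "(3 cproj \<times> 2 cproj \<times> complex) set"
  where "X_fam = {(plane_pt x y z, line_pt u v, t) | x y z u v t.
    (x, y, z) \<noteq> (0, 0, 0) \<and> (u, v) \<noteq> (0, 0) \<and> y * v\<^sup>2 - z * u\<^sup>2 - t * x * u * v = 0}"

definition fam_proj :: "3 cproj \<times> 2 cproj \<times> complex \<Rightarrow> complex"
  where "fam_proj p = snd (snd p)"

definition incl0 :: "3 cproj \<times> 2 cproj \<Rightarrow> 3 cproj \<times> 2 cproj \<times> complex"
  where "incl0 q = (fst q, snd q, 0)"

lemma incl0_F2: "incl0 ` F2 = {p \<in> X_fam. fam_proj p = 0}"
proof
  show "incl0 ` F2 \<subseteq> {p \<in> X_fam. fam_proj p = 0}"
  proof
    fix p assume "p \<in> incl0 ` F2"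
    then obtain q where q: "q \<in> F2" "p = incl0 q" by blast
    from q(1) obtain x y z u v where xyz: "q = (plane_pt x y z, line_pt u v)"
      "(x, y, z) \<noteq> (0, 0, 0)" "(u, v) \<noteq> (0, 0)" "y * v\<^sup>2 = z * u\<^sup>2"
      unfolding F2_def mem_Collect_eq by blast
    have p: "p = (plane_pt x y z, line_pt u v, 0)"
      using q(2) xyz(1) by (simp add: incl0_def)
    have "y * v\<^sup>2 - z * u\<^sup>2 - 0 * x * u * v = 0" using xyz(4) by simp
    with xyz(2,3) p have "p \<in> X_fam" unfolding X_fam_def mem_Collect_eq by blast
    with p show "p \<in> {p \<in> X_fam. fam_proj p = 0}" by (simp add: fam_proj_def)
  qed
  show "{p \<in> X_fam. fam_proj p = 0} \<subseteq> incl0 ` F2"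
  proof
    fix p assume "p \<in> {p \<in> X_fam. fam_proj p = 0}"
    then have "p \<in> X_fam" and t: "fam_proj p = 0" by simp_all
    from this(1) obtain x y z u v t where p: "p = (plane_pt x y z, line_pt u v, t)"
      "(x, y, z) \<noteq> (0, 0, 0)" "(u, v) \<noteq> (0, 0)" "y * v\<^sup>2 - z * u\<^sup>2 - t * x * u * v = 0"
      unfolding X_fam_def mem_Collect_eq by blast
    have t: "t = 0" using t p(1) by (simp add: fam_proj_def)
    have "y * v\<^sup>2 = z * u\<^sup>2" using p(4) t by simp
    with p(2,3) have "(plane_pt x y z, line_pt u v) \<in> F2" unfolding F2_def by blast
    moreover have "p = incl0 (plane_pt x y z, line_pt u v)"
      using p(1) t by (simp add: incl0_def)
    ultimately show "p \<in> incl0 ` F2" by blast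
  qed
qed

lemma X_fam_iff:
  assumes "(x, y, z) \<noteq> (0, 0, 0)" "(u, v) \<noteq> (0, 0)"
  shows "(plane_pt x y z, line_pt u v, t) \<in> X_fam \<longleftrightarrow> y * v\<^sup>2 - z * u\<^sup>2 - t * x * u * v = 0"
proof
  assume "(plane_pt x y z, line_pt u v, t) \<in> X_fam"
  then obtain x' y' z' u' v' where *: "(x', y', z') \<noteq> (0, 0, 0)" "(u', v') \<noteq> (0, 0)"
    "plane_pt x y z = plane_pt x' y' z'" "line_pt u v = line_pt u' v'"
    "y' * v'\<^sup>2 - z' * u'\<^sup>2 - t * x' * u' * v' = 0"
    unfolding X_fam_def mem_Collect_eq prod.inject by blast
  obtain c where c: "c \<noteq> 0" "x' = c * x" "y' = c * y" "z' = c * z"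
    using *(3) plane_pt_eq_iff[OF assms(1) *(1)] by blast
  obtain e where e: "e \<noteq> 0" "u' = e * u" "v' = e * v"
    using *(4) line_pt_eq_iff[OF assms(2) *(2)] by blast
  have "(c * e\<^sup>2) * (y * v\<^sup>2 - z * u\<^sup>2 - t * x * u * v) = 0"
    using *(5) unfolding c e by (simp add: algebra_simps power2_eq_square)
  then show "y * v\<^sup>2 - z * u\<^sup>2 - t * x * u * v = 0" using c e by simp
next
  assume "y * v\<^sup>2 - z * u\<^sup>2 - t * x * u * v = 0"
  with assms show "(plane_pt x y z, line_pt u v, t) \<in> X_fam"
    unfolding X_fam_def by blast
qed

section \<open>The torus and its action\<close>

definition torus :: "(complex \<times> complex) set"
  where "torus = {(a, d). a \<noteq> 0 \<and> d \<noteq> 0}"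

definition torus_mult :: "complex \<times> complex \<Rightarrow> complex \<times> complex \<Rightarrow> complex \<times> complex"
  where "torus_mult g h = (fst g * fst h, snd g * snd h)"

definition torus_act :: "complex \<times> complex \<Rightarrow> 3 cproj \<times> 2 cproj \<Rightarrow> 3 cproj \<times> 2 cproj"
  where "torus_act g q =
    (let a = fst g; d = snd g; p = rep_cproj (fst q); w = rep_cproj (snd q)
     in (plane_pt (p $ 1) (a\<^sup>2 * p $ 2) (d\<^sup>2 * p $ 3), line_pt (a * w $ 1) (d * w $ 2)))"

text \<open>On the torus, the value does not depend on the representatives chosen above.\<close>

lemma torus_act_eq:
  assumes "a \<noteq> 0" "d \<noteq> 0" "(x, y, z) \<noteq> (0, 0, 0)" "(u, v) \<noteq> (0, 0)"
  shows "torus_act (a, d) (plane_pt x y z, line_pt u v) =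
    (plane_pt x (a\<^sup>2 * y) (d\<^sup>2 * z), line_pt (a * u) (d * v))"
proof -
  let ?p = "rep_cproj (plane_pt x y z)" and ?w = "rep_cproj (line_pt u v)"
  have "(vector [x, y, z] :: complex ^ 3) \<noteq> 0" "(vector [u, v] :: complex ^ 2) \<noteq> 0"
    using assms by (simp_all add: vector_3_eq_0_iff vector_2_eq_0_iff)
  then have "\<exists>c. c \<noteq> 0 \<and> ?p = c *s vector [x, y, z]" "\<exists>e. e \<noteq> 0 \<and> ?w = e *s vector [u, v]"
    by (simp_all flip: abs_cproj_eq_iff
        add: rep_cproj_nonzero abs_rep_cproj plane_pt_def line_pt_def)
  then obtain c e where ce: "c \<noteq> 0" "?p = c *s vector [x, y, z]"
      "e \<noteq> 0" "?w = e *s vector [u, v]"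
    by blast
  have "plane_pt x (a\<^sup>2 * y) (d\<^sup>2 * z) = plane_pt (?p $ 1) (a\<^sup>2 * ?p $ 2) (d\<^sup>2 * ?p $ 3)"
    using assms ce(1) unfolding ce(2)
    by (subst plane_pt_eq_iff) (auto intro!: exI[of _ c])
  moreover have "line_pt (a * u) (d * v) = line_pt (a * ?w $ 1) (d * ?w $ 2)"
    using assms ce(3) unfolding ce(4)
    by (subst line_pt_eq_iff) (auto intro!: exI[of _ e])
  ultimately show ?thesis by (simp add: torus_act_def Let_def)
qed

lemma torus_act_F2:
  assumes "g \<in> torus" "q \<in> F2"
  shows "torus_act g q \<in> F2"
proof -
  obtain a d where g: "g = (a, d)" "a \<noteq> 0" "d \<noteq> 0" using assms(1) by (auto simp: torus_def)
  obtain x y z u v where q: "q = (plane_pt x y z, line_pt u v)"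
      "(x, y, z) \<noteq> (0, 0, 0)" "(u, v) \<noteq> (0, 0)" "y * v\<^sup>2 = z * u\<^sup>2"
    using assms(2) unfolding F2_def mem_Collect_eq by blast
  have "(a\<^sup>2 * y) * (d * v)\<^sup>2 = (d\<^sup>2 * z) * (a * u)\<^sup>2"
    using q(4) by (simp add: power_mult_distrib mult_ac)
  moreover have "(x, a\<^sup>2 * y, d\<^sup>2 * z) \<noteq> (0, 0, 0)" "(a * u, d * v) \<noteq> (0, 0)"
    using g q(2,3) by auto
  ultimately show ?thesis
    unfolding g(1) q(1) torus_act_eq[OF g(2,3) q(2,3)] F2_def by blast
qed

section \<open>Holomorphic maps into the family\<close>

definition hom_coords :: "((complex ^ 3) \<times> (complex ^ 2) \<times> complex) set"
  where "hom_coords = {(p, w, t). p \<noteq> 0 \<and> w \<noteq> 0}"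

definition hom_pt :: "(complex ^ 3) \<times> (complex ^ 2) \<times> complex \<Rightarrow> 3 cproj \<times> 2 cproj \<times> complex"
  where "hom_pt = (\<lambda>(p, w, t). (abs_cproj p, abs_cproj w, t))"

text \<open>Holomorphy on a subset \<open>W\<close> of \<open>G \<times> \<X>\<close>: as \<open>\<X>\<close> is an embedded complex submanifold, the map
  must locally be the restriction of a holomorphic map between the ambient manifolds
  \<open>G \<times> \<PP>\<^sup>2 \<times> \<PP>\<^sup>1 \<times> \<C>\<close> and \<open>\<PP>\<^sup>2 \<times> \<PP>\<^sup>1 \<times> \<C>\<close>. Maps between the latter are
  holomorphic iff they are locally given by holomorphic functions of homogeneous coordinates,
  since \<^const>\<open>hom_pt\<close> is a surjective holomorphic submersion (it has local holomorphic
  sections).\<close>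

definition holomorphic_on_family ::
    "((complex \<times> complex) \<times> (3 cproj \<times> 2 cproj \<times> complex) \<Rightarrow> 3 cproj \<times> 2 cproj \<times> complex)
      \<Rightarrow> ((complex \<times> complex) \<times> (3 cproj \<times> 2 cproj \<times> complex)) set \<Rightarrow> bool"
  where "holomorphic_on_family \<Phi> W \<longleftrightarrow>
    (\<forall>g \<xi>. \<xi> \<in> hom_coords \<and> (g, hom_pt \<xi>) \<in> W \<longrightarrow>
      (\<exists>N F. (g, \<xi>) \<in> N \<and> holomorphic_map_on F N \<and>
        (\<forall>g' \<xi>'. (g', \<xi>') \<in> N \<and> \<xi>' \<in> hom_coords \<and> (g', hom_pt \<xi>') \<in> W \<longrightarrow>
          F (g', \<xi>') \<in> hom_coords \<and> \<Phi> (g', hom_pt \<xi>') = hom_pt (F (g', \<xi>')))))"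

section \<open>Extensions of the action\<close>

text \<open>\<open>W\<close> and \<open>V\<close> are the domains of definition of the local actions \<open>\<Phi>\<close> on the family and
  \<open>\<phi>\<close> on the base.\<close>

definition extends_action ::
    "((complex \<times> complex) \<times> (3 cproj \<times> 2 cproj \<times> complex)) set
      \<Rightarrow> ((complex \<times> complex) \<times> (3 cproj \<times> 2 cproj \<times> complex) \<Rightarrow> 3 cproj \<times> 2 cproj \<times> complex)
      \<Rightarrow> ((complex \<times> complex) \<times> complex) set
      \<Rightarrow> ((complex \<times> complex) \<times> complex \<Rightarrow> complex) \<Rightarrow> bool"
  where "extends_action W \<Phi> V \<phi> \<longleftrightarrow>
    openin (top_of_set (torus \<times> X_fam)) W \<and> {(1, 1)} \<times> incl0 ` F2 \<subseteq> W \<and>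
    \<Phi> ` W \<subseteq> X_fam \<and> holomorphic_on_family \<Phi> W \<and>
    openin (top_of_set (torus \<times> UNIV)) V \<and> ((1, 1), 0) \<in> V \<and>
    holomorphic_map_on \<phi> V \<and>
    (\<forall>p. ((1, 1), p) \<in> W \<longrightarrow> \<Phi> ((1, 1), p) = p) \<and>
    (\<forall>g h p. (h, p) \<in> W \<and> (g, \<Phi> (h, p)) \<in> W \<and> (torus_mult g h, p) \<in> W \<longrightarrow>
      \<Phi> (g, \<Phi> (h, p)) = \<Phi> (torus_mult g h, p)) \<and>
    (\<forall>t. ((1, 1), t) \<in> V \<longrightarrow> \<phi> ((1, 1), t) = t) \<and>
    (\<forall>g h t. (h, t) \<in> V \<and> (g, \<phi> (h, t)) \<in> V \<and> (torus_mult g h, t) \<in> V \<longrightarrow>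
      \<phi> (g, \<phi> (h, t)) = \<phi> (torus_mult g h, t)) \<and>
    (\<forall>g p. (g, p) \<in> W \<and> (g, fam_proj p) \<in> V \<longrightarrow> fam_proj (\<Phi> (g, p)) = \<phi> (g, fam_proj p)) \<and>
    (\<forall>g q. q \<in> F2 \<and> (g, incl0 q) \<in> W \<longrightarrow> \<Phi> (g, incl0 q) = incl0 (torus_act g q))"

definition acts_trivially_on_base ::
    "(complex \<times> complex) set \<Rightarrow> ((complex \<times> complex) \<times> complex) set
      \<Rightarrow> ((complex \<times> complex) \<times> complex \<Rightarrow> complex) \<Rightarrow> bool"
  where "acts_trivially_on_base H V \<phi> \<longleftrightarrow>
    (\<exists>N. openin (top_of_set (H \<times> UNIV)) N \<and> ((1, 1), 0) \<in> N \<and> N \<subseteq> V \<and>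
      (\<forall>h t. (h, t) \<in> N \<longrightarrow> \<phi> (h, t) = t))"

end

theory Submission
  imports Defs "HOL-Complex_Analysis.Cauchy_Integral_Formula"
begin

text \<open>
  The idea is that the base direction is the tangent space \<open>H\<^sup>1(T)\<close> of the deformation functor, so any extension
  must act on it with the weight \<open>a d\<close> by which \<open>(a, d)\<close> acts on the Kodaira-Spencer class. Precisely, for
  every \<open>(a, d)\<close> near \<open>(1, 1)\<close> the map \<open>t \<mapsto> \<phi> ((a, d), t)\<close> has derivative \<open>a d\<close> at \<open>0\<close>
  (\<open>base_derivative\<close>). As \<open>a d \<noteq> 1\<close> for suitable elements of either factor arbitrarily close to \<open>1\<close>, neither
  factor, and hence not \<open>G\<close>, acts trivially on the base (\<open>not_trivial_on_base\<close>).

  The cohomological argument can be made elementary on the negative curve \<open>E = {y = z = t = 0}\<close>, a projective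
  line with coordinate \<open>[u:v]\<close>. Near it \<open>Y = y/x\<close> and \<open>Z = z/x\<close> are functions, and \<open>\<X>\<close> has the equation
  \<open>Y v\<^sup>2 - Z u\<^sup>2 - t u v = 0\<close>. Fix \<open>g = (a, d)\<close>. Let \<open>A(u)\<close> be the derivative of \<open>Z \<circ> \<Phi> (g, -)\<close> along the
  arc \<open>([1:\<tau>u:0],[u:1],\<tau>)\<close> at \<open>\<tau> = 0\<close>, and let \<open>B(v)\<close> be the derivative of \<open>Y \<circ> \<Phi> (g, -)\<close> along the arc
  \<open>([1:0:-\<tau>v],[1:v],\<tau>)\<close>. Both are holomorphic (\<open>holomorphic_on_partial_deriv\<close>). At a common point
  \<open>v = u\<inverse>\<close> of \<open>E\<close> the two arcs differ to first order by a vector tangent to the central fiber, where \<open>\<Phi>\<close>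
  is prescribed. So the equation of \<open>\<X>\<close>, differentiated along the image of the first arc, gives
  \<open>B(u\<inverse>) + a\<^sup>2 u - A(u) (a u/d)\<^sup>2 - \<phi>' a u/d = 0\<close>
  (\<open>rates_relation\<close>). Divided by \<open>u\<close>, its first term has only negative powers of \<open>u\<close>, its third one only
  positive powers, and the constant term reads \<open>a\<^sup>2 = \<phi>' a/d\<close>, that is \<open>\<phi>' = a d\<close>.
\<close>

section \<open>Complex differentiability at a point\<close>

text \<open>The pointwise condition inside \<^const>\<open>holomorphic_map_on\<close>.\<close>

definition cdiff_at ::
    "('a::{complex_vector,real_normed_vector} \<Rightarrow> 'b::{complex_vector,real_normed_vector}) \<Rightarrow> 'a \<Rightarrow> bool"
  where "cdiff_at f x \<longleftrightarrow>
    (\<exists>D. (f has_derivative D) (at x) \<and> (\<forall>c v. D (scaleC c v) = scaleC c (D v)))"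

lemma cdiff_at_compose:
  assumes "cdiff_at g x" "cdiff_at f (g x)"
  shows "cdiff_at (\<lambda>y. f (g y)) x"
proof -
  obtain G where G: "(g has_derivative G) (at x)" "\<And>c v. G (scaleC c v) = scaleC c (G v)"
    using assms(1) unfolding cdiff_at_def by blast
  obtain F where F: "(f has_derivative F) (at (g x))" "\<And>c v. F (scaleC c v) = scaleC c (F v)"
    using assms(2) unfolding cdiff_at_def by blast
  have "((\<lambda>y. f (g y)) has_derivative (\<lambda>v. F (G v))) (at x)"
    using diff_chain_at[OF G(1) F(1)] by (simp add: o_def)
  then show ?thesis
    unfolding cdiff_at_def using F(2) G(2) by (intro exI[of _ "\<lambda>v. F (G v)"]) simp
qed

lemma cdiff_at_imp_isCont: "cdiff_at f x \<Longrightarrow> isCont f x"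
  unfolding cdiff_at_def by (blast intro: has_derivative_continuous)

lemma cdiff_at_cong:
  assumes "\<forall>\<^sub>F y in nhds x. f y = g y" "cdiff_at g x"
  shows "cdiff_at f x"
proof -
  from assms(1) obtain S where S: "open S" "x \<in> S" "\<And>y. y \<in> S \<Longrightarrow> f y = g y"
    by (auto simp: eventually_nhds)
  show ?thesis
    using assms(2) has_derivative_transform_within_open[OF _ S(1,2), of g _ UNIV f] S(3)
    unfolding cdiff_at_def by (metis)
qed

lemma cdiff_at_linear:
  assumes "bounded_linear f" "\<And>c v. f (scaleC c v) = scaleC c (f v)"
  shows "cdiff_at f x"
  unfolding cdiff_at_def using assms bounded_linear_imp_has_derivative by blast

lemma scaleC_zero_right: "scaleC c (0::'a::complex_vector) = 0"
  using scaleC_add_right[of c 0 "0::'a"] by simp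

lemma cdiff_at_const: "cdiff_at (\<lambda>y. c) x"
  unfolding cdiff_at_def by (intro exI[of _ "\<lambda>_. 0"]) (simp add: scaleC_zero_right)

lemma cdiff_at_id: "cdiff_at (\<lambda>y. y) x"
  by (intro cdiff_at_linear bounded_linear_ident) simp

lemma cdiff_at_fst: "cdiff_at f x \<Longrightarrow> cdiff_at (\<lambda>y. fst (f y)) x"
  by (erule cdiff_at_compose) (intro cdiff_at_linear bounded_linear_fst, simp add: scaleC_prod_def)

lemma cdiff_at_snd: "cdiff_at f x \<Longrightarrow> cdiff_at (\<lambda>y. snd (f y)) x"
  by (erule cdiff_at_compose) (intro cdiff_at_linear bounded_linear_snd, simp add: scaleC_prod_def)

lemma cdiff_at_nth:
  fixes f :: "_ \<Rightarrow> complex ^ 'n::finite"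
  shows "cdiff_at f x \<Longrightarrow> cdiff_at (\<lambda>y. f y $ i) x"
  by (erule cdiff_at_compose) (intro cdiff_at_linear bounded_linear_vec_nth, simp add: scaleC_vec_def)

lemma cdiff_at_Pair:
  assumes "cdiff_at f x" "cdiff_at g x"
  shows "cdiff_at (\<lambda>y. (f y, g y)) x"
proof -
  obtain F where F: "(f has_derivative F) (at x)" "\<And>c v. F (scaleC c v) = scaleC c (F v)"
    using assms(1) unfolding cdiff_at_def by blast
  obtain G where G: "(g has_derivative G) (at x)" "\<And>c v. G (scaleC c v) = scaleC c (G v)"
    using assms(2) unfolding cdiff_at_def by blast
  show ?thesis
    unfolding cdiff_at_def using has_derivative_Pair[OF F(1) G(1)] F(2) G(2)
    by (intro exI[of _ "\<lambda>v. (F v, G v)"]) (simp add: scaleC_prod_def)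
qed

lemma cdiff_at_complex_iff: "cdiff_at f x \<longleftrightarrow> f field_differentiable at x"
  for f :: "complex \<Rightarrow> complex"
proof
  assume "cdiff_at f x"
  then obtain D where D: "(f has_derivative D) (at x)" "\<And>c v. D (c * v) = c * D v"
    unfolding cdiff_at_def scaleC_complex_def by blast
  have "D = (*) (D 1)"
  proof
    show "D c = D 1 * c" for c
      using D(2)[of c 1] by (metis mult.commute mult.right_neutral)
  qed
  with D(1) show "f field_differentiable at x"
    by (metis field_differentiable_def has_field_derivative_def)
next
  assume "f field_differentiable at x"
  then show "cdiff_at f x"
    by (auto simp: cdiff_at_def field_differentiable_def has_field_derivative_def scaleC_complex_def)
qed

lemma
  fixes f :: "'a::{complex_vector,real_normed_vector} \<Rightarrow> complex" and g :: "'a \<Rightarrow> complex"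
  assumes "cdiff_at f x" "cdiff_at g x"
  shows cdiff_at_add: "cdiff_at (\<lambda>y. f y + g y) x"
    and cdiff_at_mult: "cdiff_at (\<lambda>y. f y * g y) x"
proof -
  obtain F where F: "(f has_derivative F) (at x)" "\<And>c v. F (scaleC c v) = c * F v"
    using assms(1) unfolding cdiff_at_def scaleC_complex_def by blast
  obtain G where G: "(g has_derivative G) (at x)" "\<And>c v. G (scaleC c v) = c * G v"
    using assms(2) unfolding cdiff_at_def scaleC_complex_def by blast
  show "cdiff_at (\<lambda>y. f y + g y) x"
    unfolding cdiff_at_def scaleC_complex_def using has_derivative_add[OF F(1) G(1)] F(2) G(2)
    by (intro exI[of _ "\<lambda>v. F v + G v"]) (simp add: algebra_simps)
  show "cdiff_at (\<lambda>y. f y * g y) x"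
    unfolding cdiff_at_def scaleC_complex_def using has_derivative_mult[OF F(1) G(1)] F(2) G(2)
    by (intro exI[of _ "\<lambda>v. f x * G v + F v * g x"]) (simp add: algebra_simps)
qed

lemma cdiff_at_divide:
  fixes f :: "'a::{complex_vector,real_normed_vector} \<Rightarrow> complex" and g :: "'a \<Rightarrow> complex"
  assumes "cdiff_at f x" "cdiff_at g x" "g x \<noteq> 0"
  shows "cdiff_at (\<lambda>y. f y / g y) x"
proof -
  have "cdiff_at inverse (g x)"
    unfolding cdiff_at_complex_iff
    by (rule field_differentiable_inverse[OF field_differentiable_ident assms(3)])
  from cdiff_at_mult[OF assms(1) cdiff_at_compose[OF assms(2) this]]
  show ?thesis by (simp add: divide_inverse)
qed

lemma cdiff_at_uminus: "cdiff_at f x \<Longrightarrow> cdiff_at (\<lambda>y. - f y) x"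
  for f :: "'a::{complex_vector,real_normed_vector} \<Rightarrow> complex"
proof -
  assume "cdiff_at f x"
  from cdiff_at_mult[OF cdiff_at_const[of "-1"] this] show ?thesis by simp
qed

lemma cdiff_at_vector_3:
  fixes f g h :: "'a::{complex_vector,real_normed_vector} \<Rightarrow> complex"
  assumes "cdiff_at f x" "cdiff_at g x" "cdiff_at h x"
  shows "cdiff_at (\<lambda>y. vector [f y, g y, h y] :: complex ^ 3) x"
proof -
  define L :: "complex \<times> complex \<times> complex \<Rightarrow> complex ^ 3"
    where "L = (\<lambda>p. vector [fst p, fst (snd p), snd (snd p)])"
  have "linear L"
    by (rule linearI) (simp_all add: L_def vec_eq_iff forall_3)
  then have "cdiff_at L p" for p
    by (intro cdiff_at_linear)
      (simp_all add: linear_conv_bounded_linear L_def vec_eq_iff forall_3 scaleC_vec_def scaleC_prod_def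
        scaleC_complex_def)
  from cdiff_at_compose[OF cdiff_at_Pair[OF assms(1) cdiff_at_Pair[OF assms(2,3)]] this]
  show ?thesis by (simp add: L_def)
qed

lemma cdiff_at_vector_2:
  fixes f g :: "'a::{complex_vector,real_normed_vector} \<Rightarrow> complex"
  assumes "cdiff_at f x" "cdiff_at g x"
  shows "cdiff_at (\<lambda>y. vector [f y, g y] :: complex ^ 2) x"
proof -
  define L :: "complex \<times> complex \<Rightarrow> complex ^ 2" where "L = (\<lambda>p. vector [fst p, snd p])"
  have "linear L"
    by (rule linearI) (simp_all add: L_def vec_eq_iff forall_2)
  then have "cdiff_at L p" for p
    by (intro cdiff_at_linear)
      (simp_all add: linear_conv_bounded_linear L_def vec_eq_iff forall_2 scaleC_vec_def scaleC_prod_def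
        scaleC_complex_def)
  from cdiff_at_compose[OF cdiff_at_Pair[OF assms] this] show ?thesis by (simp add: L_def)
qed

lemmas cdiff_at_intros =
  cdiff_at_const cdiff_at_id cdiff_at_fst cdiff_at_snd cdiff_at_nth cdiff_at_Pair
  cdiff_at_add cdiff_at_mult cdiff_at_uminus cdiff_at_vector_2 cdiff_at_vector_3

section \<open>Holomorphic dependence on a parameter\<close>

text \<open>The point is uniformity: the bound depends on \<open>f\<close> only through \<open>M\<close>. It comes from Taylor's
  formula, the second derivative on the half-size disc being controlled by Cauchy's inequality.\<close>

lemma Cauchy_linear_remainder:
  assumes f: "f holomorphic_on ball 0 R" and R: "0 < R"
    and M: "\<And>w. w \<in> ball 0 R \<Longrightarrow> cmod (f w) \<le> M"
    and \<tau>: "cmod \<tau> < R / 2"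
  shows "cmod (f \<tau> - f 0 - deriv f 0 * \<tau>) \<le> 32 * (M + 1) / R\<^sup>2 * (cmod \<tau>)\<^sup>2"
proof -
  \<comment> \<open>Cauchy's inequality on discs of radius \<open>R / 4\<close> gives \<open>2 (M + 1) (4 / R)\<^sup>2\<close>.\<close>
  define B where "B = 32 * (M + 1) / R\<^sup>2"
  have B: "cmod ((deriv ^^ 2) f w) \<le> B" if w: "w \<in> ball 0 (R/2)" for w
  proof -
    have sub: "cball w (R/4) \<subseteq> ball 0 R"
    proof
      fix z assume "z \<in> cball w (R/4)"
      then have "cmod (w - z) \<le> R/4" "cmod w < R/2" using w by (auto simp: dist_norm)
      moreover have "cmod z \<le> cmod w + cmod (w - z)"
        by (metis add.commute norm_minus_commute norm_triangle_sub)
      ultimately show "z \<in> ball 0 R" using R by auto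
    qed
    have "cmod ((deriv ^^ 2) f w) \<le> fact 2 * (M + 1) / (R/4)^2"
    proof (rule Cauchy_higher_deriv_bound[where y = 0])
      show "f holomorphic_on ball w (R/4)"
        using f sub ball_subset_cball by (meson holomorphic_on_subset subset_trans)
      show "continuous_on (cball w (R/4)) f"
        using f sub by (meson holomorphic_on_imp_continuous_on continuous_on_subset)
      show "f z \<in> ball 0 (M + 1)" if "z \<in> ball w (R/4)" for z
      proof -
        have "z \<in> ball 0 R" using sub that ball_subset_cball by blast
        from M[OF this] show ?thesis by simp
      qed
    qed (use R in auto)
    also have "\<dots> = B" using R by (simp add: B_def field_simps power2_eq_square)
    finally show ?thesis .
  qed
  have "cmod ((deriv ^^ 0) f \<tau> - (\<Sum>i\<le>1. (deriv ^^ i) f 0 * (\<tau> - 0) ^ i / fact i))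
      \<le> B * cmod (\<tau> - 0) ^ Suc 1 / fact 1"
  proof (rule complex_Taylor[where f = "\<lambda>i. (deriv ^^ i) f" and S = "ball 0 (R/2)" and n = 1])
    fix i x assume x: "x \<in> ball (0::complex) (R/2)"
    have "(deriv ^^ i) f holomorphic_on ball 0 R" using f holomorphic_higher_deriv by blast
    moreover have "x \<in> ball 0 R" using x R by auto
    ultimately have "((deriv ^^ i) f has_field_derivative deriv ((deriv ^^ i) f) x) (at x)"
      by (meson holomorphic_derivI open_ball)
    then show "((deriv ^^ i) f has_field_derivative (deriv ^^ Suc i) f x) (at x within ball 0 (R/2))"
      by (auto intro: DERIV_subset)
    show "cmod ((deriv ^^ Suc 1) f x) \<le> B"
      using B[OF x] by (simp add: numeral_2_eq_2)
  qed (use \<tau> R in auto)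
  moreover have "(deriv ^^ 0) f \<tau> - (\<Sum>i\<le>1. (deriv ^^ i) f 0 * (\<tau> - 0) ^ i / fact i) = f \<tau> - f 0 - deriv f 0 * \<tau>"
    by simp
  ultimately show ?thesis by (simp add: B_def power2_eq_square diff_diff_eq)
qed

text \<open>Only complex differentiability of \<open>G\<close> at each point is at hand, so nothing is known a priori about
  how \<open>\<partial>G/\<partial>\<tau>\<close> varies with \<open>u\<close>. But \<open>G\<close> is locally bounded, hence by the previous lemma the difference
  quotients in \<open>\<tau>\<close>, which are holomorphic in \<open>u\<close>, converge locally uniformly.\<close>

lemma holomorphic_on_partial_deriv:
  fixes G :: "complex \<times> complex \<Rightarrow> complex"
  assumes S: "open S" and G: "\<And>u. u \<in> S \<Longrightarrow> \<forall>\<^sub>F p in nhds (u, 0). cdiff_at G p"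
  shows "(\<lambda>u. deriv (\<lambda>\<tau>. G (u, \<tau>)) 0) holomorphic_on S"
proof -
  have "\<exists>e>0. (\<lambda>u. deriv (\<lambda>\<tau>. G (u, \<tau>)) 0) holomorphic_on ball u0 e" if u0: "u0 \<in> S" for u0
  proof -
    obtain T where T: "open T" "(u0, 0) \<in> T" "\<And>p. p \<in> T \<Longrightarrow> cdiff_at G p"
      using G[OF u0] by (auto simp: eventually_nhds)
    obtain U1 U2 where U: "open U1" "open U2" "(u0, 0) \<in> U1 \<times> U2" "U1 \<times> U2 \<subseteq> T"
      using open_prod_elim[OF T(1,2)] by metis
    obtain e where e: "e > 0" "cball u0 e \<subseteq> U1" using U by (meson SigmaD1 open_contains_cball)
    obtain R where R: "R > 0" "cball 0 R \<subseteq> U2" using U by (meson SigmaD2 open_contains_cball)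
    have diff: "cdiff_at G (u, \<tau>)" if "u \<in> cball u0 e" "\<tau> \<in> cball 0 R" for u \<tau>
      using T(3) U(4) e R that by blast
    have cont: "continuous_on (cball u0 e \<times> cball 0 R) G"
      using diff by (intro continuous_at_imp_continuous_on) (auto intro: cdiff_at_imp_isCont)
    have "bounded (G ` (cball u0 e \<times> cball 0 R))"
      by (intro compact_imp_bounded compact_continuous_image cont compact_Times compact_cball)
    then obtain M where M: "\<And>u \<tau>. u \<in> cball u0 e \<Longrightarrow> \<tau> \<in> cball 0 R \<Longrightarrow> cmod (G (u, \<tau>)) \<le> M"
      unfolding bounded_iff by blast
    have M0: "M \<ge> 0" using M[of u0 0] e R by (meson centre_in_cball less_imp_le norm_ge_zero order_trans)
    have hol1: "(\<lambda>\<tau>. G (u, \<tau>)) holomorphic_on cball 0 R" if "u \<in> cball u0 e" for u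
    proof -
      have "(\<lambda>\<tau>. G (u, \<tau>)) field_differentiable at \<tau>" if "\<tau> \<in> cball 0 R" for \<tau>
        unfolding cdiff_at_complex_iff[symmetric]
        by (rule cdiff_at_compose[where f = G])
          (use diff \<open>u \<in> cball u0 e\<close> that in \<open>auto intro!: cdiff_at_intros\<close>)
      then show ?thesis
        by (auto simp: holomorphic_on_def intro: field_differentiable_at_within)
    qed
    have hol2: "(\<lambda>u. G (u, \<tau>)) holomorphic_on cball u0 e" if "\<tau> \<in> cball 0 R" for \<tau>
    proof -
      have "(\<lambda>u. G (u, \<tau>)) field_differentiable at u" if "u \<in> cball u0 e" for u
        unfolding cdiff_at_complex_iff[symmetric]
        by (rule cdiff_at_compose[where f = G])
          (use diff \<open>\<tau> \<in> cball 0 R\<close> that in \<open>auto intro!: cdiff_at_intros\<close>)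
      then show ?thesis
        by (auto simp: holomorphic_on_def intro: field_differentiable_at_within)
    qed
    define C where "C = 32 * (M + 1) / R\<^sup>2"
    have "C > 0" using M0 R by (simp add: C_def)
    have quot: "dist ((G (u, \<tau>) - G (u, 0)) / \<tau>) (deriv (\<lambda>\<tau>. G (u, \<tau>)) 0) \<le> C * cmod \<tau>"
      if "u \<in> cball u0 e" "\<tau> \<noteq> 0" "cmod \<tau> < R/2" for u \<tau>
    proof -
      have "cmod (G (u, \<tau>) - G (u, 0) - deriv (\<lambda>\<tau>. G (u, \<tau>)) 0 * \<tau>) \<le> C * (cmod \<tau>)\<^sup>2"
        unfolding C_def
      proof (rule Cauchy_linear_remainder)
        show "(\<lambda>\<tau>. G (u, \<tau>)) holomorphic_on ball 0 R"
          using hol1[OF that(1)] ball_subset_cball holomorphic_on_subset by blast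
        show "cmod (G (u, w)) \<le> M" if "w \<in> ball 0 R" for w
          using M[OF \<open>u \<in> cball u0 e\<close>, of w] that by auto
      qed (use R that in auto)
      moreover have "G (u, \<tau>) - G (u, 0) - deriv (\<lambda>\<tau>. G (u, \<tau>)) 0 * \<tau> =
          \<tau> * ((G (u, \<tau>) - G (u, 0)) / \<tau> - deriv (\<lambda>\<tau>. G (u, \<tau>)) 0)"
        using that by (simp add: field_simps)
      ultimately have "cmod \<tau> * cmod ((G (u, \<tau>) - G (u, 0)) / \<tau> - deriv (\<lambda>\<tau>. G (u, \<tau>)) 0)
          \<le> cmod \<tau> * (C * cmod \<tau>)"
        by (simp add: norm_mult power2_eq_square mult_ac)
      then show ?thesis using that by (simp add: dist_norm)
    qed
    have lim: "uniform_limit (cball u0 e) (\<lambda>\<tau> u. (G (u, \<tau>) - G (u, 0)) / \<tau>)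
        (\<lambda>u. deriv (\<lambda>\<tau>. G (u, \<tau>)) 0) (at 0)"
    proof (rule uniform_limitI)
      fix \<epsilon> :: real assume "\<epsilon> > 0"
      define \<delta> where "\<delta> = min (R/2) (\<epsilon> / C)"
      have "\<delta> > 0" using R \<open>\<epsilon> > 0\<close> \<open>C > 0\<close> by (simp add: \<delta>_def)
      then have "\<forall>\<^sub>F \<tau> in at 0. \<tau> \<noteq> 0 \<and> cmod \<tau> < \<delta>"
        by (auto simp: eventually_at dist_norm)
      then show "\<forall>\<^sub>F \<tau> in at 0. \<forall>u\<in>cball u0 e.
          dist ((G (u, \<tau>) - G (u, 0)) / \<tau>) (deriv (\<lambda>\<tau>. G (u, \<tau>)) 0) < \<epsilon>"
      proof (rule eventually_mono, intro ballI)
        fix \<tau> u assume \<tau>: "\<tau> \<noteq> 0 \<and> cmod \<tau> < \<delta>" and u: "u \<in> cball u0 e"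
        have "C * cmod \<tau> < \<epsilon>" using \<tau> \<open>C > 0\<close> by (simp add: \<delta>_def field_simps)
        then show "dist ((G (u, \<tau>) - G (u, 0)) / \<tau>) (deriv (\<lambda>\<tau>. G (u, \<tau>)) 0) < \<epsilon>"
          using quot[OF u, of \<tau>] \<tau> by (simp add: \<delta>_def)
      qed
    qed
    have hol: "\<forall>\<^sub>F \<tau> in at 0. continuous_on (cball u0 e) (\<lambda>u. (G (u, \<tau>) - G (u, 0)) / \<tau>) \<and>
        (\<lambda>u. (G (u, \<tau>) - G (u, 0)) / \<tau>) holomorphic_on ball u0 e"
    proof -
      have "\<forall>\<^sub>F \<tau> in at 0. \<tau> \<noteq> 0 \<and> cmod \<tau> < R"
        using R(1) by (auto simp: eventually_at dist_norm)
      then show ?thesis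
      proof (rule eventually_mono)
        fix \<tau> assume \<tau>: "\<tau> \<noteq> 0 \<and> cmod \<tau> < R"
        then have "(\<lambda>u. (G (u, \<tau>) - G (u, 0)) / \<tau>) holomorphic_on cball u0 e"
          using R by (intro holomorphic_intros hol2) auto
        then show "continuous_on (cball u0 e) (\<lambda>u. (G (u, \<tau>) - G (u, 0)) / \<tau>) \<and>
            (\<lambda>u. (G (u, \<tau>) - G (u, 0)) / \<tau>) holomorphic_on ball u0 e"
          using holomorphic_on_imp_continuous_on holomorphic_on_subset ball_subset_cball by blast
      qed
    qed
    have "(\<lambda>u. deriv (\<lambda>\<tau>. G (u, \<tau>)) 0) holomorphic_on ball u0 e"
      by (rule holomorphic_uniform_limit[OF hol lim at_neq_bot])
    with e(1) show ?thesis by blast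
  qed
  note local = this
  show ?thesis
    unfolding holomorphic_on_def
  proof
    fix u0 assume "u0 \<in> S"
    from local[OF this] obtain e where e: "e > 0"
      "(\<lambda>u. deriv (\<lambda>\<tau>. G (u, \<tau>)) 0) holomorphic_on ball u0 e"
      by blast
    from holomorphic_on_imp_differentiable_at[OF e(2) open_ball] e(1)
    have "(\<lambda>u. deriv (\<lambda>\<tau>. G (u, \<tau>)) 0) field_differentiable at u0"
      by simp
    then show "(\<lambda>u. deriv (\<lambda>\<tau>. G (u, \<tau>)) 0) field_differentiable at u0 within S"
      by (rule field_differentiable_at_within)
  qed
qed

lemma mean_value_circle:
  assumes "f holomorphic_on cball 0 1"
  shows "((\<lambda>x. f (exp (2 * of_real pi * \<i> * of_real x))) has_integral f 0) {0..1}"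
proof -
  have "((\<lambda>u. f u / (u - 0)) has_contour_integral (2 * of_real pi * \<i> * f 0)) (circlepath 0 1)"
    by (rule Cauchy_integral_circlepath_simple) (use assms in auto)
  then have "((\<lambda>x. f (exp (2 * of_real pi * \<i> * of_real x)) * (2 * of_real pi * \<i>)) has_integral
      2 * of_real pi * \<i> * f 0) {0..1}"
    unfolding has_contour_integral vector_derivative_circlepath
    by (simp add: circlepath mult_ac)
  from has_integral_mult_right[OF this, of "1 / (2 * of_real pi * \<i>)"] show ?thesis
    by simp
qed

text \<open>Substituting \<open>u \<mapsto> u\<inverse>\<close> on the unit circle only reverses its orientation, so it preserves mean values.
  In other words, a Laurent series that has both a non-negative and a non-positive expansion is constant;
  this is the only global fact about \<open>\<PP>\<^sup>1\<close> in the proof.\<close>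

lemma values_at_0_eq_if_inverse_on_circle:
  assumes "f holomorphic_on cball 0 1" "g holomorphic_on cball 0 1"
    and eq: "\<And>u. cmod u = 1 \<Longrightarrow> f u = g (inverse u)"
  shows "f 0 = g 0"
proof -
  let ?e = "\<lambda>x::real. exp (2 * of_real pi * \<i> * of_real x) :: complex"
  have "((\<lambda>x. g (?e x)) has_integral g 0) (cbox 0 1)"
    using mean_value_circle[OF assms(2)] by simp
  from has_integral_affinity[OF this, of "-1" 1]
  have "((\<lambda>x. g (?e (1 - x))) has_integral g 0) {0..1}"
    by (simp add: image_affinity_atLeastAtMost algebra_simps)
  moreover have "g (?e (1 - x)) = f (?e x)" for x
  proof -
    have "?e (1 - x) = exp (2 * of_real pi * \<i>) * exp (- (2 * of_real pi * \<i> * of_real x))"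
      by (simp only: exp_add[symmetric]) (simp add: algebra_simps)
    then have "?e (1 - x) = inverse (?e x)"
      by (simp only: exp_two_pi_i exp_minus mult_1)
    moreover have "cmod (?e x) = 1"
      by (simp add: norm_exp_eq_Re)
    ultimately show ?thesis using eq[of "?e x"] by simp
  qed
  ultimately have "((\<lambda>x. f (?e x)) has_integral g 0) {0..1}" by simp
  from has_integral_unique[OF mean_value_circle[OF assms(1)] this] show ?thesis .
qed

section \<open>Coordinates on the family\<close>

text \<open>For \<open>k = 2, 3\<close> these are \<open>y/x\<close> and \<open>z/x\<close>. Since division by zero gives zero, the degenerate case \<open>k = 1\<close>
  is the indicator of \<open>x \<noteq> 0\<close>; being \<open>1\<close> at a point and continuous, it shows that nearby points stay in the chart.
  Likewise \<open>line_ratio\<close> is \<open>u/v\<close> for \<open>k = 1\<close> and the indicator of \<open>v \<noteq> 0\<close> for \<open>k = 2\<close>.\<close>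

definition plane_ratio :: "3 \<Rightarrow> 3 cproj \<times> 2 cproj \<times> complex \<Rightarrow> complex"
  where "plane_ratio k p = rep_cproj (fst p) $ k / rep_cproj (fst p) $ 1"

definition line_ratio :: "2 \<Rightarrow> 3 cproj \<times> 2 cproj \<times> complex \<Rightarrow> complex"
  where "line_ratio k p = rep_cproj (fst (snd p)) $ k / rep_cproj (fst (snd p)) $ 2"

lemma rep_abs_cproj:
  assumes "v \<noteq> 0"
  obtains c where "c \<noteq> 0" "rep_cproj (abs_cproj v) = c *s v"
  using abs_cproj_eq_iff[OF assms rep_cproj_nonzero[of "abs_cproj v"]] abs_rep_cproj by metis

lemma plane_ratio_hom_pt:
  assumes "\<xi> \<in> hom_coords"
  shows "plane_ratio k (hom_pt \<xi>) = fst \<xi> $ k / fst \<xi> $ 1"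
proof -
  obtain P w t where \<xi>: "\<xi> = (P, w, t)" "P \<noteq> 0" using assms by (auto simp: hom_coords_def)
  obtain c where "c \<noteq> 0" "rep_cproj (abs_cproj P) = c *s P" using rep_abs_cproj[OF \<xi>(2)] .
  then show ?thesis by (simp add: plane_ratio_def hom_pt_def \<xi>)
qed

lemma line_ratio_hom_pt:
  assumes "\<xi> \<in> hom_coords"
  shows "line_ratio k (hom_pt \<xi>) = fst (snd \<xi>) $ k / fst (snd \<xi>) $ 2"
proof -
  obtain P w t where \<xi>: "\<xi> = (P, w, t)" "w \<noteq> 0" using assms by (auto simp: hom_coords_def)
  obtain c where "c \<noteq> 0" "rep_cproj (abs_cproj w) = c *s w" using rep_abs_cproj[OF \<xi>(2)] .
  then show ?thesis by (simp add: line_ratio_def hom_pt_def \<xi>)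
qed

lemma open_hom_coords: "open hom_coords"
proof -
  have *: "hom_coords = {\<xi>. fst \<xi> \<noteq> 0} \<inter> {\<xi>. fst (snd \<xi>) \<noteq> 0}" by (auto simp: hom_coords_def)
  show ?thesis unfolding * by (intro open_Int open_Collect_neq continuous_intros)
qed

lemma hom_coords_vector:
  assumes "(x, y, z) \<noteq> (0, 0, 0)" "(u, v) \<noteq> (0, 0)"
  shows "(vector [x, y, z], vector [u, v], t) \<in> hom_coords"
  using assms by (auto simp: hom_coords_def vector_3_eq_0_iff vector_2_eq_0_iff)

lemma hom_pt_vector: "hom_pt (vector [x, y, z], vector [u, v], t) = (plane_pt x y z, line_pt u v, t)"
  by (simp add: hom_pt_def plane_pt_def line_pt_def)

lemma plane_ratio_plane_pt:
  "plane_ratio 2 (plane_pt 1 y z, q) = y"  "plane_ratio 3 (plane_pt 1 y z, q) = z"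
  "plane_ratio 1 (plane_pt 1 y z, q) = 1"
proof -
  have "(vector [1, y, z] :: complex ^ 3) \<noteq> 0" by (simp add: vector_3_eq_0_iff)
  then obtain c where "c \<noteq> 0" "rep_cproj (plane_pt 1 y z) = c *s vector [1, y, z]"
    unfolding plane_pt_def by (rule rep_abs_cproj)
  then show "plane_ratio 2 (plane_pt 1 y z, q) = y"  "plane_ratio 3 (plane_pt 1 y z, q) = z"
    "plane_ratio 1 (plane_pt 1 y z, q) = 1"
    by (simp_all add: plane_ratio_def)
qed

lemma line_ratio_line_pt:
  assumes "v \<noteq> 0"
  shows "line_ratio 1 (p, line_pt u v, t) = u / v" "line_ratio 2 (p, line_pt u v, t) = 1"
proof -
  have "(vector [u, v] :: complex ^ 2) \<noteq> 0" using assms by (simp add: vector_2_eq_0_iff)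
  then obtain c where "c \<noteq> 0" "rep_cproj (line_pt u v) = c *s vector [u, v]"
    unfolding line_pt_def by (rule rep_abs_cproj)
  then show "line_ratio 1 (p, line_pt u v, t) = u / v" "line_ratio 2 (p, line_pt u v, t) = 1"
    using assms by (simp_all add: line_ratio_def)
qed

lemma X_fam_affine:
  assumes "p \<in> X_fam" "plane_ratio 1 p \<noteq> 0" "line_ratio 2 p \<noteq> 0"
  shows "plane_ratio 2 p - plane_ratio 3 p * (line_ratio 1 p)\<^sup>2 - fam_proj p * line_ratio 1 p = 0"
proof -
  obtain x y z u v t where p: "p = (plane_pt x y z, line_pt u v, t)"
    "(x, y, z) \<noteq> (0, 0, 0)" "(u, v) \<noteq> (0, 0)" "y * v\<^sup>2 - z * u\<^sup>2 - t * x * u * v = 0"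
    using assms(1) unfolding X_fam_def mem_Collect_eq by blast
  let ?\<xi> = "(vector [x, y, z], vector [u, v], t) :: (complex ^ 3) \<times> (complex ^ 2) \<times> complex"
  have p': "p = hom_pt ?\<xi>" by (simp add: p hom_pt_vector)
  have hom: "?\<xi> \<in> hom_coords" using p by (intro hom_coords_vector)
  have "x \<noteq> 0" "v \<noteq> 0"
    using assms(2,3) unfolding p' plane_ratio_hom_pt[OF hom] line_ratio_hom_pt[OF hom] by auto
  then have "y / x - z / x * (u / v)\<^sup>2 - t * (u / v)
      = (y * v\<^sup>2 - z * u\<^sup>2 - t * x * u * v) / (x * v\<^sup>2)"
    by (simp add: field_simps power2_eq_square)
  then show ?thesis
    unfolding p' plane_ratio_hom_pt[OF hom] line_ratio_hom_pt[OF hom]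
    using p(4) by (simp add: fam_proj_def hom_pt_def)
qed

text \<open>Holomorphy of a function on \<open>\<PP>\<^sup>2 \<times> \<PP>\<^sup>1 \<times> \<complex>\<close> near a point, tested on all homogeneous coordinates, because
  \<^const>\<open>holomorphic_on_family\<close> only provides some local lift, with unspecified scalar factors.\<close>

definition regular_at :: "(3 cproj \<times> 2 cproj \<times> complex \<Rightarrow> complex) \<Rightarrow> 3 cproj \<times> 2 cproj \<times> complex \<Rightarrow> bool"
  where "regular_at Q p \<longleftrightarrow>
    (\<forall>\<xi>\<in>hom_coords. hom_pt \<xi> = p \<longrightarrow> (\<forall>\<^sub>F \<eta> in nhds \<xi>. cdiff_at (\<lambda>\<zeta>. Q (hom_pt \<zeta>)) \<eta>))"

lemma regular_atI:
  assumes "open U" "\<And>\<xi>. \<xi> \<in> hom_coords \<Longrightarrow> hom_pt \<xi> = p \<Longrightarrow> \<xi> \<in> U"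
    and "\<And>\<xi>. \<xi> \<in> U \<Longrightarrow> cdiff_at q \<xi>"
    and "\<And>\<xi>. \<xi> \<in> hom_coords \<Longrightarrow> Q (hom_pt \<xi>) = q \<xi>"
  shows "regular_at Q p"
  unfolding regular_at_def
proof (intro ballI impI)
  fix \<xi> assume "\<xi> \<in> hom_coords" "hom_pt \<xi> = p"
  then have "\<forall>\<^sub>F \<eta> in nhds \<xi>. \<eta> \<in> U \<inter> hom_coords"
    using assms(1,2) open_hom_coords by (intro eventually_nhds_in_open) auto
  then show "\<forall>\<^sub>F \<eta> in nhds \<xi>. cdiff_at (\<lambda>\<zeta>. Q (hom_pt \<zeta>)) \<eta>"
  proof (rule eventually_mono)
    fix \<eta> assume \<eta>: "\<eta> \<in> U \<inter> hom_coords"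
    have "\<forall>\<^sub>F \<zeta> in nhds \<eta>. \<zeta> \<in> hom_coords"
      using \<eta> open_hom_coords by (intro eventually_nhds_in_open) auto
    then have "\<forall>\<^sub>F \<zeta> in nhds \<eta>. Q (hom_pt \<zeta>) = q \<zeta>"
      by (rule eventually_mono) (rule assms(4))
    from cdiff_at_cong[OF this assms(3)] \<eta>
    show "cdiff_at (\<lambda>\<zeta>. Q (hom_pt \<zeta>)) \<eta>" by blast
  qed
qed

lemma regular_at_plane_ratio:
  assumes "plane_ratio 1 p \<noteq> 0"
  shows "regular_at (plane_ratio k) p"
proof (rule regular_atI)
  show "open {\<xi>::(complex ^ 3) \<times> (complex ^ 2) \<times> complex. fst \<xi> $ 1 \<noteq> 0}"
    by (intro open_Collect_neq continuous_intros)
  show "\<xi> \<in> {\<xi>::(complex ^ 3) \<times> (complex ^ 2) \<times> complex. fst \<xi> $ 1 \<noteq> 0}" if "\<xi> \<in> hom_coords" "hom_pt \<xi> = p" for \<xi>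
    using assms plane_ratio_hom_pt[OF that(1), of 1] that(2) by auto
  show "cdiff_at (\<lambda>\<xi>. fst \<xi> $ k / fst \<xi> $ 1) \<xi>" if "\<xi> \<in> {\<xi>::(complex ^ 3) \<times> (complex ^ 2) \<times> complex. fst \<xi> $ 1 \<noteq> 0}"
    for \<xi> :: "(complex ^ 3) \<times> (complex ^ 2) \<times> complex"
    using that by (intro cdiff_at_divide cdiff_at_intros) auto
qed (rule plane_ratio_hom_pt)

lemma regular_at_line_ratio:
  assumes "line_ratio 2 p \<noteq> 0"
  shows "regular_at (line_ratio k) p"
proof (rule regular_atI)
  show "open {\<xi>::(complex ^ 3) \<times> (complex ^ 2) \<times> complex. fst (snd \<xi>) $ 2 \<noteq> 0}"
    by (intro open_Collect_neq continuous_intros)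
  show "\<xi> \<in> {\<xi>::(complex ^ 3) \<times> (complex ^ 2) \<times> complex. fst (snd \<xi>) $ 2 \<noteq> 0}" if "\<xi> \<in> hom_coords" "hom_pt \<xi> = p" for \<xi>
    using assms line_ratio_hom_pt[OF that(1), of 2] that(2) by auto
  show "cdiff_at (\<lambda>\<xi>. fst (snd \<xi>) $ k / fst (snd \<xi>) $ 2) \<xi>" if "\<xi> \<in> {\<xi>::(complex ^ 3) \<times> (complex ^ 2) \<times> complex. fst (snd \<xi>) $ 2 \<noteq> 0}"
    for \<xi> :: "(complex ^ 3) \<times> (complex ^ 2) \<times> complex"
    using that by (intro cdiff_at_divide cdiff_at_intros) auto
qed (rule line_ratio_hom_pt)

lemma continuous_on_abs_cproj: "continuous_on {v::complex ^ 'n::finite. v \<noteq> 0} abs_cproj"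
proof -
  have "open {v::complex ^ 'n. v \<noteq> 0}" by (intro open_Collect_neq continuous_intros)
  moreover have "abs_cproj -` B \<inter> {v::complex ^ 'n. v \<noteq> 0} = {v. v \<noteq> 0 \<and> abs_cproj v \<in> B}" for B
    by auto
  ultimately show ?thesis
    by (simp add: continuous_on_open_vimage open_cproj_def)
qed

lemma continuous_on_hom_pt: "continuous_on hom_coords hom_pt"
proof -
  have *: "hom_pt = (\<lambda>\<xi>. (abs_cproj (fst \<xi>), abs_cproj (fst (snd \<xi>)), snd (snd \<xi>)))"
    by (auto simp: hom_pt_def)
  have "continuous_on hom_coords (\<lambda>\<xi>. abs_cproj (fst \<xi>))"
    by (rule continuous_on_compose2[OF continuous_on_abs_cproj])
      (auto simp: hom_coords_def intro!: continuous_intros)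
  moreover have "continuous_on hom_coords (\<lambda>\<xi>. abs_cproj (fst (snd \<xi>)))"
    by (rule continuous_on_compose2[OF continuous_on_abs_cproj])
      (auto simp: hom_coords_def intro!: continuous_intros)
  ultimately show ?thesis
    unfolding * by (intro continuous_intros)
qed

lemma isCont_hom_pt: "\<xi> \<in> hom_coords \<Longrightarrow> isCont hom_pt \<xi>"
  using continuous_on_hom_pt open_hom_coords by (simp add: continuous_on_eq_continuous_at)

lemma isCont_imp_tendsto_nhds: "isCont f x \<Longrightarrow> (f \<longlongrightarrow> f x) (nhds x)"
  by (simp add: isCont_def tendsto_at_iff_tendsto_nhds)

lemma has_field_derivative_along:
  fixes f :: "complex \<times> complex \<Rightarrow> complex"
  assumes "(f has_derivative L) (at 0)" "\<And>c v. L (scaleC c v) = scaleC c (L v)"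
  shows "((\<lambda>\<tau>. f (\<tau> * \<alpha>, \<tau> * \<beta>)) has_field_derivative L (\<alpha>, \<beta>)) (at 0)"
proof -
  have "((\<lambda>\<tau>. (\<tau> * \<alpha>, \<tau> * \<beta>)) has_derivative (\<lambda>\<tau>. (\<tau> * \<alpha>, \<tau> * \<beta>))) (at 0)"
    by (auto intro!: derivative_eq_intros)
  from diff_chain_at[OF this, of f L] assms(1)
  have "((\<lambda>\<tau>. f (\<tau> * \<alpha>, \<tau> * \<beta>)) has_derivative (\<lambda>\<tau>. L (\<tau> * \<alpha>, \<tau> * \<beta>))) (at 0)"
    by (simp add: o_def zero_prod_def)
  moreover have "L (\<tau> * \<alpha>, \<tau> * \<beta>) = L (\<alpha>, \<beta>) * \<tau>" for \<tau>
    using assms(2)[of \<tau> "(\<alpha>, \<beta>)"] by (simp add: scaleC_prod_def scaleC_complex_def)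
  ultimately show ?thesis by (simp add: has_field_derivative_def)
qed

text \<open>The negative curve \<open>y = z = 0\<close> of the Hirzebruch surface: its self-intersection is \<open>-2\<close>.\<close>

abbreviation neg_curve :: "complex \<Rightarrow> complex \<Rightarrow> 3 cproj \<times> 2 cproj \<times> complex"
  where "neg_curve u v \<equiv> (plane_pt 1 0 0, line_pt u v, 0)"

text \<open>The chart of \<open>\<X>\<close> over \<open>x = v = 1\<close>, in coordinates \<open>(u, (z, t))\<close>: there the equation of \<open>\<X>\<close> reads
  \<open>y = z u\<^sup>2 + t u\<close>.\<close>

definition family_chart :: "complex \<Rightarrow> complex \<times> complex \<Rightarrow> (complex ^ 3) \<times> (complex ^ 2) \<times> complex"
  where "family_chart u y = (vector [1, fst y * u\<^sup>2 + snd y * u, fst y], vector [u, 1], snd y)"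

text \<open>In the chart \<open>x = u = 1\<close> the equation is \<open>z = y v\<^sup>2 - t v\<close>; this is the arc \<open>y = 0\<close>, \<open>t = \<tau>\<close> with fixed \<open>v\<close>. On
  the overlap \<open>v = u\<inverse>\<close> it differs from the arc \<open>z = 0\<close>, \<open>t = \<tau>\<close> of the first chart.\<close>

definition opposite_arc :: "complex \<Rightarrow> complex \<Rightarrow> (complex ^ 3) \<times> (complex ^ 2) \<times> complex"
  where "opposite_arc v \<tau> = (vector [1, 0, - (\<tau> * v)], vector [1, v], \<tau>)"

lemma family_chart_hom: "family_chart u y \<in> hom_coords"
  unfolding family_chart_def by (intro hom_coords_vector) auto

lemma family_chart_X_fam: "hom_pt (family_chart u y) \<in> X_fam"
  unfolding family_chart_def hom_pt_vector
  by (subst X_fam_iff) (auto simp: algebra_simps power2_eq_square)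

lemma opposite_arc_hom: "opposite_arc v \<tau> \<in> hom_coords"
  unfolding opposite_arc_def by (intro hom_coords_vector) auto

lemma opposite_arc_X_fam: "hom_pt (opposite_arc v \<tau>) \<in> X_fam"
  unfolding opposite_arc_def hom_pt_vector by (subst X_fam_iff) auto

section \<open>Extended actions\<close>

locale extended_action =
  fixes W :: "((complex \<times> complex) \<times> (3 cproj \<times> 2 cproj \<times> complex)) set"
    and \<Phi> :: "(complex \<times> complex) \<times> (3 cproj \<times> 2 cproj \<times> complex)
      \<Rightarrow> 3 cproj \<times> 2 cproj \<times> complex"
    and V :: "((complex \<times> complex) \<times> complex) set"
    and \<phi> :: "(complex \<times> complex) \<times> complex \<Rightarrow> complex"
  assumes extends: "extends_action W \<Phi> V \<phi>"
begin

lemma W_open: "openin (top_of_set (torus \<times> X_fam)) W"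
  and F2_W: "q \<in> F2 \<Longrightarrow> ((1, 1), incl0 q) \<in> W"
  and \<Phi>_X_fam: "(g, p) \<in> W \<Longrightarrow> \<Phi> (g, p) \<in> X_fam"
  and \<Phi>_hol: "holomorphic_on_family \<Phi> W"
  and V_open: "openin (top_of_set (torus \<times> UNIV)) V"
  and V_origin: "((1, 1), 0) \<in> V"
  and \<phi>_hol: "holomorphic_map_on \<phi> V"
  and equivariant: "(g, p) \<in> W \<Longrightarrow> (g, fam_proj p) \<in> V \<Longrightarrow> fam_proj (\<Phi> (g, p)) = \<phi> (g, fam_proj p)"
  and \<Phi>_F2: "q \<in> F2 \<Longrightarrow> (g, incl0 q) \<in> W \<Longrightarrow> \<Phi> (g, incl0 q) = incl0 (torus_act g q)"
  using extends unfolding extends_action_def by blast+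

lemma eventually_in_W:
  assumes "isCont c x" "(g, hom_pt (c x)) \<in> W"
    and hom: "\<And>y. c y \<in> hom_coords" and X: "\<And>y. hom_pt (c y) \<in> X_fam"
  shows "\<forall>\<^sub>F y in nhds x. (g, hom_pt (c y)) \<in> W"
proof -
  obtain T where T: "open T" "W = torus \<times> X_fam \<inter> T"
    using W_open by (auto simp: openin_open)
  have "isCont (\<lambda>y. hom_pt (c y)) x"
    by (rule isCont_o2[OF assms(1) isCont_hom_pt[OF hom]])
  then have "isCont (\<lambda>y. (g, hom_pt (c y))) x"
    by (intro continuous_intros)
  then have "((\<lambda>y. (g, hom_pt (c y))) \<longlongrightarrow> (g, hom_pt (c x))) (nhds x)"
    by (rule isCont_imp_tendsto_nhds)
  then have "\<forall>\<^sub>F y in nhds x. (g, hom_pt (c y)) \<in> T"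
    using topological_tendstoD T assms(2) by fastforce
  moreover have "g \<in> torus" using assms(2) T by auto
  ultimately show ?thesis using X T by (auto elim!: eventually_mono)
qed

text \<open>The local lift \<open>F\<close> of \<open>\<Phi>\<close> is holomorphic on an open set of the ambient space but represents \<open>\<Phi>\<close> only over
  \<open>\<X>\<close>. Composing with a map \<open>c\<close> that runs inside \<open>\<X>\<close> turns this into genuine complex differentiability.\<close>

lemma cdiff_at_along:
  assumes c: "\<forall>\<^sub>F y in nhds x. cdiff_at c y \<and> c y \<in> hom_coords \<and> (g, hom_pt (c y)) \<in> W"
    and Q: "regular_at Q (\<Phi> (g, hom_pt (c x)))"
  shows "\<forall>\<^sub>F y in nhds x. cdiff_at (\<lambda>y. Q (\<Phi> (g, hom_pt (c y)))) y"
proof -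
  have x: "cdiff_at c x" "c x \<in> hom_coords" "(g, hom_pt (c x)) \<in> W"
    using eventually_nhds_x_imp_x[OF c] by auto
  obtain N F where NF: "(g, c x) \<in> N" "holomorphic_map_on F N"
    "\<And>g' \<xi>'. (g', \<xi>') \<in> N \<Longrightarrow> \<xi>' \<in> hom_coords \<Longrightarrow> (g', hom_pt \<xi>') \<in> W \<Longrightarrow>
      F (g', \<xi>') \<in> hom_coords \<and> \<Phi> (g', hom_pt \<xi>') = hom_pt (F (g', \<xi>'))"
    using \<Phi>_hol x(2,3) unfolding holomorphic_on_family_def by metis
  have N: "open N" and F: "\<And>\<eta>. \<eta> \<in> N \<Longrightarrow> cdiff_at F \<eta>"
    using NF(2) by (auto simp: holomorphic_map_on_def cdiff_at_def)
  have gc: "cdiff_at (\<lambda>y. (g, c y)) y" if "cdiff_at c y" for y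
    using that by (intro cdiff_at_intros)
  have "((\<lambda>y. (g, c y)) \<longlongrightarrow> (g, c x)) (nhds x)"
    using cdiff_at_imp_isCont[OF gc[OF x(1)]] by (rule isCont_imp_tendsto_nhds)
  then have inN: "\<forall>\<^sub>F y in nhds x. (g, c y) \<in> N"
    using topological_tendstoD N NF(1) by fastforce
  define K where "K = (\<lambda>y. F (g, c y))"
  have K: "cdiff_at K y" if "cdiff_at c y" "(g, c y) \<in> N" for y
    unfolding K_def using cdiff_at_compose[OF gc[OF that(1)] F[OF that(2)]] .
  have "\<forall>\<^sub>F \<eta> in nhds (K x). cdiff_at (\<lambda>\<zeta>. Q (hom_pt \<zeta>)) \<eta>"
    using Q NF(3)[OF NF(1) x(2,3)] unfolding regular_at_def K_def by metis
  moreover have "filterlim K (nhds (K x)) (nhds x)"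
    using cdiff_at_imp_isCont[OF K[OF x(1) NF(1)]] by (rule isCont_imp_tendsto_nhds)
  ultimately have "\<forall>\<^sub>F y in nhds x. cdiff_at (\<lambda>\<zeta>. Q (hom_pt \<zeta>)) (K y)"
    by (simp add: filterlim_iff)
  with c inN have "\<forall>\<^sub>F y in nhds x. (cdiff_at c y \<and> c y \<in> hom_coords \<and> (g, hom_pt (c y)) \<in> W) \<and>
      (g, c y) \<in> N \<and> cdiff_at (\<lambda>\<zeta>. Q (hom_pt \<zeta>)) (K y)" (is "eventually ?R _")
    by (rule eventually_conj[OF _ eventually_conj])
  then have "\<forall>\<^sub>F y in nhds x. eventually ?R (nhds y)"
    by (simp only: eventually_eventually)
  then show ?thesis
  proof (rule eventually_mono)
    fix y assume y: "eventually ?R (nhds y)"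
    from eventually_nhds_x_imp_x[OF y]
    have "cdiff_at (\<lambda>y. Q (hom_pt (K y))) y"
      using cdiff_at_compose[OF K] by blast
    moreover have "\<forall>\<^sub>F y' in nhds y. Q (\<Phi> (g, hom_pt (c y'))) = Q (hom_pt (K y'))"
      using y by (rule eventually_mono) (use NF(3) K_def in auto)
    ultimately show "cdiff_at (\<lambda>y. Q (\<Phi> (g, hom_pt (c y)))) y"
      using cdiff_at_cong[of "\<lambda>y. Q (\<Phi> (g, hom_pt (c y)))" "\<lambda>y. Q (hom_pt (K y))" y] by blast
  qed
qed

text \<open>Components of the differential of \<open>\<Phi> (g, -)\<close>, at the points of the negative curve, in the direction of the
  two local lifts of \<open>\<partial>/\<partial>t\<close>. As \<open>y/x\<close> and \<open>z/x\<close> are functions on a neighborhood of the whole curve, these are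
  honest functions of \<open>u\<close> and of \<open>v\<close>.\<close>

definition z_rate :: "complex \<times> complex \<Rightarrow> complex \<Rightarrow> complex"
  where "z_rate g u = deriv (\<lambda>\<tau>. plane_ratio 3 (\<Phi> (g, hom_pt (family_chart u (0, \<tau>))))) 0"

definition y_rate :: "complex \<times> complex \<Rightarrow> complex \<Rightarrow> complex"
  where "y_rate g v = deriv (\<lambda>\<tau>. plane_ratio 2 (\<Phi> (g, hom_pt (opposite_arc v \<tau>)))) 0"

lemma \<Phi>_neg_curve:
  assumes "(a, d) \<in> torus" "((a, d), neg_curve u v) \<in> W" "(u, v) \<noteq> (0, 0)"
  shows "\<Phi> ((a, d), neg_curve u v) = neg_curve (a * u) (d * v)"
proof -
  have "(plane_pt 1 0 0, line_pt u v) \<in> F2"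
    using assms(3) unfolding F2_def by fastforce
  from \<Phi>_F2[OF this, of "(a, d)"] assms show ?thesis
    by (simp add: incl0_def torus_act_eq torus_def)
qed

lemma z_rate_holomorphic:
  assumes "(a, d) \<in> torus"
    and E: "\<And>u v. (u, v) \<noteq> (0, 0) \<Longrightarrow> ((a, d), neg_curve u v) \<in> W"
  shows "z_rate (a, d) holomorphic_on UNIV"
proof -
  let ?c = "\<lambda>p. family_chart (fst p) (0, snd p)"
  have c: "cdiff_at ?c p" for p
    unfolding family_chart_def fst_conv snd_conv power2_eq_square by (intro cdiff_at_intros)
  have "(\<lambda>u. deriv (\<lambda>\<tau>. plane_ratio 3 (\<Phi> ((a, d), hom_pt (?c (u, \<tau>))))) 0) holomorphic_on UNIV"
  proof (rule holomorphic_on_partial_deriv)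
    fix u
    have pt: "hom_pt (?c (u, 0)) = neg_curve u 1"
      by (simp add: family_chart_def hom_pt_vector)
    have "\<forall>\<^sub>F p in nhds (u, 0). ((a, d), hom_pt (?c p)) \<in> W"
      by (rule eventually_in_W)
        (use pt E c family_chart_hom family_chart_X_fam in \<open>auto intro: cdiff_at_imp_isCont\<close>)
    then have "\<forall>\<^sub>F p in nhds (u, 0). cdiff_at ?c p \<and> ?c p \<in> hom_coords \<and> ((a, d), hom_pt (?c p)) \<in> W"
      by (rule eventually_mono) (use c family_chart_hom in auto)
    then show "\<forall>\<^sub>F p in nhds (u, 0). cdiff_at (\<lambda>p. plane_ratio 3 (\<Phi> ((a, d), hom_pt (?c p)))) p"
      by (rule cdiff_at_along)
        (use assms in \<open>simp only: pt \<Phi>_neg_curve, auto intro!: regular_at_plane_ratio simp: \<Phi>_neg_curve plane_ratio_plane_pt\<close>)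
  qed simp
  then show ?thesis by (simp add: z_rate_def[abs_def])
qed

lemma y_rate_holomorphic:
  assumes "(a, d) \<in> torus"
    and E: "\<And>u v. (u, v) \<noteq> (0, 0) \<Longrightarrow> ((a, d), neg_curve u v) \<in> W"
  shows "y_rate (a, d) holomorphic_on UNIV"
proof -
  let ?c = "\<lambda>p. opposite_arc (fst p) (snd p)"
  have c: "cdiff_at ?c p" for p
    unfolding opposite_arc_def by (intro cdiff_at_intros)
  have "(\<lambda>v. deriv (\<lambda>\<tau>. plane_ratio 2 (\<Phi> ((a, d), hom_pt (?c (v, \<tau>))))) 0) holomorphic_on UNIV"
  proof (rule holomorphic_on_partial_deriv)
    fix v
    have pt: "hom_pt (?c (v, 0)) = neg_curve 1 v"
      by (simp add: opposite_arc_def hom_pt_vector)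
    have "\<forall>\<^sub>F p in nhds (v, 0). ((a, d), hom_pt (?c p)) \<in> W"
      by (rule eventually_in_W)
        (use pt E c opposite_arc_hom opposite_arc_X_fam in \<open>auto intro: cdiff_at_imp_isCont\<close>)
    then have "\<forall>\<^sub>F p in nhds (v, 0). cdiff_at ?c p \<and> ?c p \<in> hom_coords \<and> ((a, d), hom_pt (?c p)) \<in> W"
      by (rule eventually_mono) (use c opposite_arc_hom in auto)
    then show "\<forall>\<^sub>F p in nhds (v, 0). cdiff_at (\<lambda>p. plane_ratio 2 (\<Phi> ((a, d), hom_pt (?c p)))) p"
      by (rule cdiff_at_along)
        (use assms in \<open>simp only: pt \<Phi>_neg_curve, auto intro!: regular_at_plane_ratio simp: \<Phi>_neg_curve plane_ratio_plane_pt\<close>)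
  qed simp
  then show ?thesis by (simp add: y_rate_def[abs_def])
qed

text \<open>Differentiating the equation \<open>y v\<^sup>2 - z u\<^sup>2 - t x u v = 0\<close> for the image under \<open>\<Phi> (g, -)\<close> of the arc \<open>z = 0\<close>, \<open>t = \<tau>\<close>
  gives a linear relation between \<open>\<phi>'\<close> and the derivatives of \<open>y/x\<close> and \<open>z/x\<close>. The derivative of \<open>y/x\<close> is
  then rewritten in terms of the opposite arc: the tangent vectors of the two arcs differ by \<open>u\<inverse>\<close> times \<open>(y, z, t) = (u\<^sup>2, 1, 0)\<close>,
  which is tangent to \<open>\<pi>\<inverse>(0)\<close>, where \<open>\<Phi>\<close> is the given action and multiplies \<open>y/x\<close> by \<open>a\<^sup>2\<close>. This
  correction \<open>a\<^sup>2 u\<close> is the Kodaira-Spencer cocycle of the family, transformed by \<open>g\<close>.\<close>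

lemma rates_relation:
  assumes g: "(a, d) \<in> torus"
    and E: "((a, d), neg_curve u 1) \<in> W" and "u \<noteq> 0"
    and V: "((a, d), 0) \<in> V"
    and \<phi>': "((\<lambda>t. \<phi> ((a, d), t)) has_field_derivative \<phi>') (at 0)"
  shows "y_rate (a, d) (inverse u) + a\<^sup>2 * u - z_rate (a, d) u * (a * u / d)\<^sup>2 - \<phi>' * (a * u / d) = 0"
proof -
  let ?g = "(a, d)" and ?c = "family_chart u"
  have ad: "a \<noteq> 0" "d \<noteq> 0" using g by (auto simp: torus_def)
  define h where "h Q y = Q (\<Phi> (?g, hom_pt (?c y)))" for Q :: "3 cproj \<times> 2 cproj \<times> complex \<Rightarrow> complex" and y
  have c: "cdiff_at ?c y" for y
    unfolding family_chart_def power2_eq_square by (intro cdiff_at_intros)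
  have pt: "hom_pt (?c 0) = neg_curve u 1"
    by (simp add: family_chart_def hom_pt_vector)
  have img: "\<Phi> (?g, hom_pt (?c 0)) = neg_curve (a * u) d"
    using \<Phi>_neg_curve[OF g E] pt by simp
  have inW: "\<forall>\<^sub>F y in nhds 0. (?g, hom_pt (?c y)) \<in> W"
    using pt E by (intro eventually_in_W cdiff_at_imp_isCont c family_chart_hom family_chart_X_fam) simp
  then have ev: "\<forall>\<^sub>F y in nhds 0. cdiff_at ?c y \<and> ?c y \<in> hom_coords \<and> (?g, hom_pt (?c y)) \<in> W"
    by (rule eventually_mono) (use c family_chart_hom in auto)
  have diff: "cdiff_at (h Q) 0" if "regular_at Q (\<Phi> (?g, hom_pt (?c 0)))" for Q
    unfolding h_def using eventually_nhds_x_imp_x[OF cdiff_at_along[OF ev that]] .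
  have P: "cdiff_at (h (plane_ratio k)) 0" for k
    by (rule diff, rule regular_at_plane_ratio) (simp add: img plane_ratio_plane_pt)
  have L: "cdiff_at (h (line_ratio k)) 0" for k
    by (rule diff, rule regular_at_line_ratio) (simp add: img line_ratio_line_pt ad)
  obtain Y where Y: "(h (plane_ratio 2) has_derivative Y) (at 0)" "\<And>c v. Y (scaleC c v) = scaleC c (Y v)"
    using P unfolding cdiff_at_def by blast
  obtain Z where Z: "(h (plane_ratio 3) has_derivative Z) (at 0)" "\<And>c v. Z (scaleC c v) = scaleC c (Z v)"
    using P unfolding cdiff_at_def by blast
  obtain M where M: "(h (line_ratio 1) has_derivative M) (at 0)" "\<And>c v. M (scaleC c v) = scaleC c (M v)"
    using L unfolding cdiff_at_def by blast
  note dY = has_field_derivative_along[OF Y] and dZ = has_field_derivative_along[OF Z]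
    and dM = has_field_derivative_along[OF M]
  have Yadd: "Y (p + q) = Y p + Y q" for p q
    using has_derivative_linear[OF Y(1)] by (rule linear_add)
  have vals: "h (plane_ratio 2) 0 = 0" "h (plane_ratio 3) 0 = 0" "h (line_ratio 1) 0 = a * u / d"
    by (simp_all add: h_def img plane_ratio_plane_pt line_ratio_line_pt ad)
  have z_rate: "z_rate ?g u = Z (0, 1)"
    using dZ[of 0 1] unfolding z_rate_def by (intro DERIV_imp_deriv) (simp add: h_def)
  \<comment> \<open>In the chart coordinates \<open>(z, t)\<close> the opposite arc is the line in the direction \<open>(- u\<inverse>, 1)\<close>.\<close>
  have y_rate: "y_rate ?g (inverse u) = Y (- inverse u, 1)"
  proof -
    have "hom_pt (opposite_arc (inverse u) \<tau>) = hom_pt (?c (\<tau> * - inverse u, \<tau> * 1))" for \<tau>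
    proof -
      have "line_pt 1 (inverse u) = line_pt u 1"
        using \<open>u \<noteq> 0\<close> by (subst line_pt_eq_iff) (auto intro!: exI[of _ u])
      moreover have "inverse u * u\<^sup>2 = u"
        using \<open>u \<noteq> 0\<close> by (simp add: power2_eq_square)
      ultimately show ?thesis
        by (simp add: opposite_arc_def family_chart_def hom_pt_vector mult.assoc)
    qed
    then show ?thesis
      using dY[of "- inverse u" 1] unfolding y_rate_def
      by (intro DERIV_imp_deriv) (simp add: h_def)
  qed
  \<comment> \<open>\<open>(1, 0)\<close> is the direction \<open>t = 0\<close> of the central fiber.\<close>
  have Y10: "Y (1, 0) = a\<^sup>2 * u\<^sup>2"
  proof -
    have "filterlim (\<lambda>\<tau>::complex. (\<tau>, 0::complex)) (nhds 0) (nhds 0)"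
      unfolding zero_prod_def by (intro tendsto_Pair tendsto_const filterlim_ident)
    from eventually_compose_filterlim[OF inW this]
    have "\<forall>\<^sub>F \<tau> in nhds 0. h (plane_ratio 2) (\<tau> * 1, \<tau> * 0) = a\<^sup>2 * u\<^sup>2 * \<tau>"
    proof (rule eventually_mono)
      fix \<tau> assume W: "(?g, hom_pt (?c (\<tau>, 0))) \<in> W"
      let ?q = "(plane_pt 1 (\<tau> * u\<^sup>2) \<tau>, line_pt u 1)"
      have q: "hom_pt (?c (\<tau>, 0)) = incl0 ?q"
        by (simp add: family_chart_def hom_pt_vector incl0_def)
      have "?q \<in> F2" unfolding F2_def by fastforce
      from \<Phi>_F2[OF this] W q ad
      have "\<Phi> (?g, hom_pt (?c (\<tau>, 0))) = incl0 (plane_pt 1 (a\<^sup>2 * (\<tau> * u\<^sup>2)) (d\<^sup>2 * \<tau>), line_pt (a * u) (d * 1))"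
        by (simp add: torus_act_eq)
      then show "h (plane_ratio 2) (\<tau> * 1, \<tau> * 0) = a\<^sup>2 * u\<^sup>2 * \<tau>"
        by (simp add: h_def incl0_def plane_ratio_plane_pt)
    qed
    then have "((\<lambda>\<tau>. a\<^sup>2 * u\<^sup>2 * \<tau>) has_field_derivative Y (1, 0)) (at 0)"
      using dY[of 1 0] DERIV_cong_ev[OF refl _ refl] by fast
    moreover have "((\<lambda>\<tau>. a\<^sup>2 * u\<^sup>2 * \<tau>) has_field_derivative a\<^sup>2 * u\<^sup>2) (at 0)"
      by (auto intro!: derivative_eq_intros)
    ultimately show ?thesis by (rule DERIV_unique)
  qed
  have rel: "Y (0, 1) - Z (0, 1) * (a * u / d)\<^sup>2 - \<phi>' * (a * u / d) = 0"
  proof -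
    let ?v = "\<lambda>\<tau>::complex. (\<tau> * 0, \<tau> * 1)"
    have lim: "filterlim ?v (nhds 0) (nhds 0)"
      unfolding zero_prod_def mult_zero_right mult_1_right
      by (intro tendsto_Pair tendsto_const filterlim_ident)
    have "\<forall>\<^sub>F y in nhds 0. h (plane_ratio 1) y \<noteq> 0"
      using tendsto_imp_eventually_ne[OF isCont_imp_tendsto_nhds[OF cdiff_at_imp_isCont[OF P]]]
      by (simp add: h_def img plane_ratio_plane_pt)
    moreover have "\<forall>\<^sub>F y in nhds 0. h (line_ratio 2) y \<noteq> 0"
      using tendsto_imp_eventually_ne[OF isCont_imp_tendsto_nhds[OF cdiff_at_imp_isCont[OF L]]]
      by (simp add: h_def img line_ratio_line_pt ad)
    ultimately have "\<forall>\<^sub>F y in nhds 0. (?g, hom_pt (?c y)) \<in> W \<and> h (plane_ratio 1) y \<noteq> 0 \<and> h (line_ratio 2) y \<noteq> 0"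
      using inW by (intro eventually_conj)
    from eventually_compose_filterlim[OF this lim]
    have ev1: "\<forall>\<^sub>F \<tau> in nhds 0. (?g, hom_pt (?c (?v \<tau>))) \<in> W \<and> h (plane_ratio 1) (?v \<tau>) \<noteq> 0
        \<and> h (line_ratio 2) (?v \<tau>) \<noteq> 0" .
    have ev2: "\<forall>\<^sub>F \<tau> in nhds 0. (?g, \<tau>) \<in> V"
    proof -
      have "open V" using \<phi>_hol by (simp add: holomorphic_map_on_def)
      moreover have "((\<lambda>\<tau>. (?g, \<tau>)) \<longlongrightarrow> (?g, 0)) (nhds 0)"
        by (intro tendsto_Pair tendsto_const filterlim_ident)
      ultimately show ?thesis using topological_tendstoD V by fastforce
    qed
    let ?R = "\<lambda>\<tau>. h (plane_ratio 2) (?v \<tau>) - h (plane_ratio 3) (?v \<tau>) * (h (line_ratio 1) (?v \<tau>))\<^sup>2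
        - \<phi> (?g, \<tau>) * h (line_ratio 1) (?v \<tau>)"
    have zero: "\<forall>\<^sub>F \<tau> in nhds 0. ?R \<tau> = 0"
      using ev1 ev2
    proof eventually_elim
      case (elim \<tau>)
      have "fam_proj (hom_pt (?c (?v \<tau>))) = \<tau>"
        by (simp add: family_chart_def hom_pt_def fam_proj_def)
      then have "h fam_proj (?v \<tau>) = \<phi> (?g, \<tau>)"
        using equivariant[of ?g "hom_pt (?c (?v \<tau>))"] elim by (simp add: h_def)
      then show ?case
        using X_fam_affine[OF \<Phi>_X_fam[of ?g "hom_pt (?c (?v \<tau>))"]] elim by (simp add: h_def)
    qed
    have "\<phi> (?g, 0) = 0"
      using equivariant[of ?g "hom_pt (?c 0)"] V E pt img by (simp add: fam_proj_def)
    then have "(?R has_field_derivative Y (0, 1) - Z (0, 1) * (a * u / d)\<^sup>2 - \<phi>' * (a * u / d)) (at 0)"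
      using vals by (auto intro!: derivative_eq_intros dY[of 0 1, simplified]
          dZ[of 0 1, simplified] dM[of 0 1, simplified] \<phi>' simp: zero_prod_def)
    moreover have "(?R has_field_derivative 0) (at 0)"
      using DERIV_cong_ev[OF refl zero refl] by simp
    ultimately show ?thesis by (rule DERIV_unique)
  qed
  have "Y (0, 1) = Y (- inverse u, 1) + Y (inverse u, 0)"
    using Yadd[of "(- inverse u, 1)" "(inverse u, 0)"] by simp
  moreover have "Y (inverse u, 0) = inverse u * Y (1, 0)"
    using Y(2)[of "inverse u" "(1, 0)"] by (simp add: scaleC_prod_def scaleC_complex_def)
  ultimately have "Y (0, 1) = y_rate ?g (inverse u) + a\<^sup>2 * u"
    using \<open>u \<noteq> 0\<close> by (simp add: y_rate Y10 power2_eq_square)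
  with rel z_rate show ?thesis by simp
qed

text \<open>On the unit circle the relation between the rates, divided by \<open>u\<close>, equates a holomorphic function of \<open>u\<close> with one
  of \<open>u\<inverse>\<close>, so their constant terms agree: \<open>\<phi>' a/d - a\<^sup>2 = 0\<close>. The result \<open>a d\<close> is
  the weight of \<open>t\<close> that makes the equation of \<open>\<X>\<close> semi-invariant under \<open>(y, z, u, v) \<mapsto> (a\<^sup>2 y, d\<^sup>2 z, a u, d v)\<close>.\<close>

lemma base_derivative:
  assumes g: "(a, d) \<in> torus"
    and E: "\<And>u v. (u, v) \<noteq> (0, 0) \<Longrightarrow> ((a, d), neg_curve u v) \<in> W"
    and V: "((a, d), 0) \<in> V"
  shows "((\<lambda>t. \<phi> ((a, d), t)) has_field_derivative a * d) (at 0)"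
proof -
  have ad: "a \<noteq> 0" "d \<noteq> 0" using g by (auto simp: torus_def)
  have "cdiff_at \<phi> ((a, d), 0)"
    using \<phi>_hol V by (auto simp: holomorphic_map_on_def cdiff_at_def)
  from cdiff_at_compose[OF cdiff_at_Pair[OF cdiff_at_const cdiff_at_id] this]
  have "cdiff_at (\<lambda>t. \<phi> ((a, d), t)) 0" .
  then obtain \<phi>' where \<phi>': "((\<lambda>t. \<phi> ((a, d), t)) has_field_derivative \<phi>') (at 0)"
    by (auto simp: cdiff_at_complex_iff field_differentiable_def)
  let ?f = "\<lambda>u. (a / d)\<^sup>2 * (u * z_rate (a, d) u) + \<phi>' * (a / d) - a\<^sup>2"
  let ?h = "\<lambda>v. v * y_rate (a, d) v"
  have "?f 0 = ?h 0"
  proof (rule values_at_0_eq_if_inverse_on_circle)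
    show "?f holomorphic_on cball 0 1"
      by (intro holomorphic_intros holomorphic_on_subset[OF z_rate_holomorphic[OF g E]]) auto
    show "?h holomorphic_on cball 0 1"
      by (intro holomorphic_intros holomorphic_on_subset[OF y_rate_holomorphic[OF g E]]) auto
    fix u :: complex assume "cmod u = 1"
    then have "u \<noteq> 0" by auto
    have "((a, d), neg_curve u 1) \<in> W" by (rule E) simp
    from rates_relation[OF g this \<open>u \<noteq> 0\<close> V \<phi>']
    have "y_rate (a, d) (inverse u) = z_rate (a, d) u * (a * u / d)\<^sup>2 + \<phi>' * (a * u / d) - a\<^sup>2 * u"
      by (simp add: algebra_simps)
    with \<open>u \<noteq> 0\<close> ad show "?f u = ?h (inverse u)"
      by (simp add: field_simps power2_eq_square)
  qed
  then have "\<phi>' = a * d" using ad by (simp add: field_simps power2_eq_square)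
  with \<phi>' show ?thesis by simp
qed

text \<open>Compactness of the curve, covered by two closed discs, turns the neighborhood \<open>W\<close> of \<open>{1} \<times> F\<^sub>2\<close> into a
  neighborhood of \<open>1\<close> that serves all points of the curve.\<close>

lemma eventually_neg_curve_in_domain:
  "\<forall>\<^sub>F g in nhds (1, 1). g \<in> torus \<and> (\<forall>u v. (u, v) \<noteq> (0, 0) \<longrightarrow> (g, neg_curve u v) \<in> W)
     \<and> (g, 0) \<in> V"
proof -
  obtain T where T: "open T" "W = torus \<times> X_fam \<inter> T"
    using W_open by (auto simp: openin_open)
  have tube: "\<forall>\<^sub>F g in nhds (1, 1). \<forall>s\<in>cball 0 1. (g, hom_pt (c s)) \<in> T"
    if c: "continuous_on UNIV c" "\<And>s. c s \<in> hom_coords" "\<And>s. \<exists>q\<in>F2. hom_pt (c s) = incl0 q"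
    for c :: "complex \<Rightarrow> (complex ^ 3) \<times> (complex ^ 2) \<times> complex"
  proof -
    have "continuous_on UNIV (\<lambda>s. hom_pt (c s))"
      by (rule continuous_on_compose2[OF continuous_on_hom_pt c(1)]) (use c(2) in auto)
    then have "continuous_on UNIV (\<lambda>x::(complex \<times> complex) \<times> complex. (fst x, hom_pt (c (snd x))))"
      by (intro continuous_on_Pair continuous_on_fst continuous_on_id
          continuous_on_compose2[OF _ continuous_on_snd[OF continuous_on_id]]) auto
    then have op: "open ((\<lambda>x. (fst x, hom_pt (c (snd x)))) -` T)"
      by (rule open_vimage[OF T(1)])
    have "((1, 1), hom_pt (c s)) \<in> T" for s
      using F2_W c(3)[of s] T(2) by auto
    then have "{(1, 1)} \<times> cball 0 1 \<subseteq> (\<lambda>x. (fst x, hom_pt (c (snd x)))) -` T"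
      by auto
    from Elementary_Topology.tube_lemma[OF compact_cball op this]
    obtain X0 where X0: "(1, 1) \<in> X0" "open X0"
      "X0 \<times> cball 0 1 \<subseteq> (\<lambda>x. (fst x, hom_pt (c (snd x)))) -` T"
      by (elim exE conjE)
    show ?thesis
      by (rule eventually_mono[OF eventually_nhds_in_open[OF X0(2,1)]]) (use X0(3) in auto)
  qed
  have "\<forall>\<^sub>F g in nhds (1, 1). \<forall>s\<in>cball 0 1. (g, hom_pt (family_chart s (0, 0))) \<in> T"
  proof (rule tube)
    show "continuous_on UNIV (\<lambda>s. family_chart s (0, 0))"
      unfolding family_chart_def fst_conv snd_conv
      by (intro continuous_at_imp_continuous_on ballI cdiff_at_imp_isCont)
        (simp, intro cdiff_at_intros)
    show "\<exists>q\<in>F2. hom_pt (family_chart s (0, 0)) = incl0 q" for s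
      using family_chart_X_fam[of s "(0, 0)"] incl0_F2
      by (fastforce simp: family_chart_def fam_proj_def hom_pt_def)
  qed (rule family_chart_hom)
  moreover have "\<forall>\<^sub>F g in nhds (1, 1). \<forall>s\<in>cball 0 1. (g, hom_pt (opposite_arc s 0)) \<in> T"
  proof (rule tube)
    show "continuous_on UNIV (\<lambda>s. opposite_arc s 0)"
      unfolding opposite_arc_def
      by (intro continuous_at_imp_continuous_on ballI cdiff_at_imp_isCont cdiff_at_intros)
    show "\<exists>q\<in>F2. hom_pt (opposite_arc s 0) = incl0 q" for s
      using opposite_arc_X_fam[of s 0] incl0_F2
      by (fastforce simp: opposite_arc_def fam_proj_def hom_pt_def)
  qed (rule opposite_arc_hom)
  moreover have "\<forall>\<^sub>F g in nhds (1, 1). g \<in> torus"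
  proof -
    have *: "torus = {g. fst g \<noteq> 0} \<inter> {g. snd g \<noteq> 0}" by (auto simp: torus_def)
    have "open torus" unfolding * by (intro open_Int open_Collect_neq continuous_intros)
    then show ?thesis by (rule eventually_nhds_in_open) (simp add: torus_def)
  qed
  moreover have "\<forall>\<^sub>F g in nhds (1, 1). (g, 0) \<in> V"
  proof -
    have "open V" using \<phi>_hol by (simp add: holomorphic_map_on_def)
    moreover have "((\<lambda>g. (g, 0)) \<longlongrightarrow> ((1, 1), 0)) (nhds (1, 1))"
      by (intro tendsto_Pair tendsto_const filterlim_ident)
    ultimately show ?thesis using topological_tendstoD V_origin by fastforce
  qed
  ultimately show ?thesis
  proof eventually_elim
    case (elim g)
    have "(g, neg_curve u v) \<in> W" if "(u, v) \<noteq> (0, 0)" for u v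
    proof -
      have "neg_curve u v \<in> X_fam"
        using that by (subst X_fam_iff) auto
      moreover have "(g, neg_curve u v) \<in> T"
      proof (cases "cmod u \<le> cmod v")
        case True
        then have "v \<noteq> 0" using that by auto
        then have "line_pt u v = line_pt (u / v) 1"
          by (subst line_pt_eq_iff) (auto intro!: exI[of _ "inverse v"] simp: field_simps)
        then have "hom_pt (family_chart (u / v) (0, 0)) = neg_curve u v"
          by (simp add: family_chart_def hom_pt_vector)
        moreover have "u / v \<in> cball 0 1"
          using True \<open>v \<noteq> 0\<close> by (simp add: norm_divide)
        ultimately show ?thesis using elim by metis
      next
        case False
        then have "u \<noteq> 0" by auto
        then have "line_pt u v = line_pt 1 (v / u)"
          by (subst line_pt_eq_iff) (auto intro!: exI[of _ "inverse u"] simp: field_simps)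
        then have "hom_pt (opposite_arc (v / u) 0) = neg_curve u v"
          by (simp add: opposite_arc_def hom_pt_vector)
        moreover have "v / u \<in> cball 0 1"
          using False \<open>u \<noteq> 0\<close> by (simp add: norm_divide)
        ultimately show ?thesis using elim by metis
      qed
      ultimately show ?thesis using elim T by simp
    qed
    with elim show ?case by simp
  qed
qed

text \<open>The curve \<open>\<gamma>\<close> supplies elements of \<open>H\<close> arbitrarily close to \<open>1\<close> whose weight is not \<open>1\<close>.\<close>

lemma not_trivial_on_base:
  assumes H: "H \<subseteq> torus"
    and \<gamma>: "isCont \<gamma> (0::complex)" "\<gamma> 0 = (1, 1)"
    and \<gamma>H: "\<forall>\<^sub>F s in at 0. \<gamma> s \<in> H \<and> fst (\<gamma> s) * snd (\<gamma> s) \<noteq> 1"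
  shows "\<not> acts_trivially_on_base H V \<phi>"
proof
  assume "acts_trivially_on_base H V \<phi>"
  then obtain N where N: "openin (top_of_set (H \<times> UNIV)) N" "((1, 1), 0) \<in> N"
    "\<And>h t. (h, t) \<in> N \<Longrightarrow> \<phi> (h, t) = t"
    unfolding acts_trivially_on_base_def by blast
  from N(1) obtain T where T: "open T" "N = H \<times> UNIV \<inter> T"
    by (auto simp: openin_open)
  obtain A B where AB: "open A" "open B" "((1, 1), 0) \<in> A \<times> B" "A \<times> B \<subseteq> T"
    using open_prod_elim[OF T(1)] N(2) T(2) by (metis IntD2)
  have lim: "filterlim \<gamma> (nhds (1, 1)) (at 0)"
    using \<gamma> by (simp add: isCont_def)
  have "\<forall>\<^sub>F g in nhds (1, 1). g \<in> A"
    using AB by (intro eventually_nhds_in_open) auto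
  from eventually_compose_filterlim[OF eventually_conj[OF eventually_neg_curve_in_domain this] lim] \<gamma>H
  have "\<forall>\<^sub>F s in at 0. ((\<gamma> s \<in> torus \<and>
      (\<forall>u v. (u, v) \<noteq> (0, 0) \<longrightarrow> (\<gamma> s, neg_curve u v) \<in> W) \<and> (\<gamma> s, 0) \<in> V) \<and> \<gamma> s \<in> A) \<and>
      \<gamma> s \<in> H \<and> fst (\<gamma> s) * snd (\<gamma> s) \<noteq> 1"
    by (rule eventually_conj)
  then obtain s where s: "\<gamma> s \<in> torus" "(\<gamma> s, 0) \<in> V" "\<gamma> s \<in> A" "\<gamma> s \<in> H" "fst (\<gamma> s) * snd (\<gamma> s) \<noteq> 1"
      "\<And>u v. (u, v) \<noteq> (0, 0) \<Longrightarrow> (\<gamma> s, neg_curve u v) \<in> W"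
    using eventually_happens'[OF at_neq_bot] by blast
  obtain a d where ad: "\<gamma> s = (a, d)" by (cases "\<gamma> s")
  have "((\<lambda>t. \<phi> ((a, d), t)) has_field_derivative a * d) (at 0)"
    using s unfolding ad by (intro base_derivative)
  moreover have ident: "\<forall>\<^sub>F t in nhds 0. \<phi> ((a, d), t) = t"
  proof -
    have "\<forall>\<^sub>F t in nhds 0. t \<in> B" using AB by (intro eventually_nhds_in_open) auto
    then show ?thesis
    proof (rule eventually_mono)
      fix t assume "t \<in> B"
      then have "(\<gamma> s, t) \<in> N" using T(2) AB(4) s(3,4) by auto
      then show "\<phi> ((a, d), t) = t" using N(3) ad by simp
    qed
  qed
  ultimately have "((\<lambda>t. t) has_field_derivative a * d) (at (0::complex))"
    using DERIV_cong_ev[OF refl ident refl] by simp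
  then have "a * d = 1"
    using DERIV_unique DERIV_ident by blast
  with s(5) ad show False by simp
qed

end

theorem mainTheorem2:
  fixes W :: "((complex \<times> complex) \<times> (3 cproj \<times> 2 cproj \<times> complex)) set"
    and \<Phi> :: "(complex \<times> complex) \<times> (3 cproj \<times> 2 cproj \<times> complex)
      \<Rightarrow> 3 cproj \<times> 2 cproj \<times> complex"
    and V :: "((complex \<times> complex) \<times> complex) set"
    and \<phi> :: "(complex \<times> complex) \<times> complex \<Rightarrow> complex"
  assumes "extends_action W \<Phi> V \<phi>"
  shows "\<not> acts_trivially_on_base torus V \<phi>
    \<and> \<not> acts_trivially_on_base {(a, d) \<in> torus. d = 1} V \<phi>
    \<and> \<not> acts_trivially_on_base {(a, d) \<in> torus. a = 1} V \<phi>"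
proof -
  interpret extended_action W \<Phi> V \<phi> using assms by unfold_locales
  have near0: "\<forall>\<^sub>F s::complex in at 0. s \<noteq> 0 \<and> 1 + s \<noteq> 0"
  proof (rule eventually_conj)
    have "\<forall>\<^sub>F s::complex in nhds 0. s \<noteq> - 1"
      by (intro t1_space_nhds) simp
    then show "\<forall>\<^sub>F s::complex in at 0. 1 + s \<noteq> 0"
      unfolding eventually_at_filter by (rule eventually_mono) (auto simp: add_eq_0_iff)
  qed (simp add: eventually_at_filter)
  have left: "isCont (\<lambda>s::complex. (1 + s, 1::complex)) 0" and right: "isCont (\<lambda>s::complex. (1::complex, 1 + s)) 0"
    by (intro continuous_intros)+
  show ?thesis
  proof (intro conjI)
    show "\<not> acts_trivially_on_base torus V \<phi>"
      by (rule not_trivial_on_base[OF _ left]) (use near0 in \<open>auto simp: torus_def elim!: eventually_mono\<close>)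
    show "\<not> acts_trivially_on_base {(a, d) \<in> torus. d = 1} V \<phi>"
      by (rule not_trivial_on_base[OF _ left]) (use near0 in \<open>auto simp: torus_def elim!: eventually_mono\<close>)
    show "\<not> acts_trivially_on_base {(a, d) \<in> torus. a = 1} V \<phi>"
      by (rule not_trivial_on_base[OF _ right]) (use near0 in \<open>auto simp: torus_def elim!: eventually_mono\<close>)
  qed
qed

end
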